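(* Let $\mathcal{F}$ be a finite family of graphs such that $\mathcal{F}$ contains a bipartite graph, a co-bipartite graph and a split graph, and suppose that $\mathcal{F}$ has the Erdős–Hajnal property. Then there exist constants $a>0$ and $b>0$, depending only on $\mathcal{F}$, such that for every $\varepsilon>0$ there is $\delta$ with $\delta \geq a\varepsilon^{b}$ and $\delta>0$ such that the following holds. For every $n$-vertex graph $G$ with $n \geq 1/\delta$, if for every $F \in \mathcal{F}$ the graph $G$ contains fewer than $\delta n^{|V(F)|}$ induced copies of $F$, then $G$ contains an $\varepsilon$-homogeneous set $X$ with $|X| \geq \delta n$.
   Context: A graph is co-bipartite if its complement is bipartite; a graph is split if its vertex set can be partitioned into a clique and an independent set. A graph $G$ is induced $\mathcal{F}$-free if no induced subgraph of $G$ is isomorphic to a member of $\mathcal{F}$. A family $\mathcal{F}$ has the Erdős–Hajnal property if there is $c=c(\mathcal{F})>0$ such that every $n$-vertex induced $\mathcal{F}$-free graph contains a clique or an independent set of size at least $c n^{c}$. An induced copy of $F$ in $G$ is a set of $|V(F)|$ vertices of $G$ whose induced subgraph is isomorphic to $F$. For a vertex set $X$ with $|X|\ge 2$, its edge density is $d(X)=e(X)/\binom{|X|}{2}$, where $e(X)$ is the number of edges of $G$ with both endpoints in $X$; $X$ is $\varepsilon$-homogeneous if $d(X)\le \varepsilon$ or $d(X)\ge 1-\varepsilon$.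
   Formalization: The claim is proved for 0 < ε ≤ 1 instead of every ε > 0 (for large ε, aε^b > 1 forces δ > 1 and |X| ≥ δn > n is impossible); the graphs G have natural numbers as vertices, which covers all finite graphs up to isomorphism. *)

theory Defs
  imports Complex_Main "HOL-Library.Ramsey"
begin

text \<open>
  Finite simple graphs are pairs (vertices, edges) with edges as two-element sets of
  vertices, the convention under which \<^const>\<open>clique\<close> and \<^const>\<open>indep\<close> of
  \<^theory>\<open>HOL-Library.Ramsey\<close> are stated.
\<close>

type_synonym 'v ugraph = "'v set \<times> 'v set set"

abbreviation vertices :: "'v ugraph \<Rightarrow> 'v set" where
  "vertices G \<equiv> fst G"

abbreviation edges :: "'v ugraph \<Rightarrow> 'v set set" where
  "edges G \<equiv> snd G"

definition simple_graph :: "'v ugraph \<Rightarrow> bool" where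
  "simple_graph G \<longleftrightarrow> finite (vertices G) \<and> edges G \<subseteq> [vertices G]\<^bsup>2\<^esup>"

definition complement :: "'v ugraph \<Rightarrow> 'v ugraph" where
  "complement G = (vertices G, [vertices G]\<^bsup>2\<^esup> - edges G)"

definition induced :: "'v ugraph \<Rightarrow> 'v set \<Rightarrow> 'v ugraph" where
  "induced G X = (X, {e \<in> edges G. e \<subseteq> X})"

definition isomorphic :: "'v ugraph \<Rightarrow> 'w ugraph \<Rightarrow> bool" where
  "isomorphic G H \<longleftrightarrow>
     (\<exists>f. bij_betw f (vertices G) (vertices H) \<and>
          (\<forall>u\<in>vertices G. \<forall>v\<in>vertices G. {u, v} \<in> edges G \<longleftrightarrow> {f u, f v} \<in> edges H))"

text \<open>The two parts below may be empty.\<close>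

definition bipartite :: "'v ugraph \<Rightarrow> bool" where
  "bipartite G \<longleftrightarrow>
     (\<exists>A B. A \<union> B = vertices G \<and> A \<inter> B = {} \<and> indep A (edges G) \<and> indep B (edges G))"

definition cobipartite :: "'v ugraph \<Rightarrow> bool" where
  "cobipartite G \<longleftrightarrow> bipartite (complement G)"

definition split_graph :: "'v ugraph \<Rightarrow> bool" where
  "split_graph G \<longleftrightarrow>
     (\<exists>A B. A \<union> B = vertices G \<and> A \<inter> B = {} \<and> clique A (edges G) \<and> indep B (edges G))"

definition induced_free :: "'f ugraph set \<Rightarrow> 'v ugraph \<Rightarrow> bool" where
  "induced_free \<F> G \<longleftrightarrow>
     (\<forall>X \<subseteq> vertices G. \<forall>F\<in>\<F>. \<not> isomorphic (induced G X) F)"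

text \<open>Host graphs live on \<^typ>\<open>nat\<close>: every finite graph is isomorphic to one of these.\<close>

definition erdos_hajnal :: "'f ugraph set \<Rightarrow> bool" where
  "erdos_hajnal \<F> \<longleftrightarrow>
     (\<exists>c::real. c > 0 \<and>
        (\<forall>G :: nat ugraph. simple_graph G \<and> induced_free \<F> G \<longrightarrow>
           (\<exists>S \<subseteq> vertices G. (clique S (edges G) \<or> indep S (edges G)) \<and>
              real (card S) \<ge> c * real (card (vertices G)) powr c)))"

definition induced_copies :: "'f ugraph \<Rightarrow> 'v ugraph \<Rightarrow> 'v set set" where
  "induced_copies F G =
     {X. X \<subseteq> vertices G \<and> card X = card (vertices F) \<and> isomorphic (induced G X) F}"

definition edge_density :: "'v ugraph \<Rightarrow> 'v set \<Rightarrow> real" where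
  "edge_density G X = real (card (edges (induced G X))) / real (card X choose 2)"

definition homogeneous :: "real \<Rightarrow> 'v ugraph \<Rightarrow> 'v set \<Rightarrow> bool" where
  "homogeneous \<epsilon> G X \<longleftrightarrow>
     X \<subseteq> vertices G \<and> card X \<ge> 2 \<and> (edge_density G X \<le> \<epsilon> \<or> edge_density G X \<ge> 1 - \<epsilon>)"

end

theory Submission
  imports Defs
begin

text \<open>
  By Ramsey's theorem, a graph in which a large vertex set is shattered by neighbourhoods contains
  every bipartite, every co-bipartite or every split graph of bounded order, so it is not
  \<open>\<F>\<close>-free.  Hence if \<open>G\<close> contains few copies of members of \<open>\<F>\<close>, a random sample of
  polynomially many vertices shatters no large set, and by the Sauer--Shelah lemma many vertices
  of \<open>G\<close> have nearly equal neighbourhoods.  Greedily, half of \<open>G\<close> is covered by disjoint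
  clusters of near-twins of linear size, and between most pairs of clusters the density is close to
  0 or 1.  A random sample from the clusters is \<open>\<F>\<close>-free and reflects these densities, so a large
  clique or independent set in it, which the Erdos--Hajnal property provides, spans a family of
  clusters whose union is homogeneous.
\<close>

section \<open>Bounded shattering in induced-free graphs\<close>

text \<open>Every parameter has to be polynomial in \<open>1 / \<epsilon>\<close>, which enters as
  an integer \<open>e\<close>. The delicate one is the number \<open>N\<close> of test vertices in
  the first sample: they must separate all pairs among \<open>k = D * N ^ D + 1\<close> non-twins,
  and \<open>k\<close> grows with \<open>N\<close>. A test vertex misses a given pair with
  probability at most \<open>1 - 1 / g\<close>, so the failure probability decays exponentially in
  \<open>N\<close>, while the number of pairs is only polynomial in \<open>N\<close>; an
  \<open>N\<close> of order \<open>g ^ 2\<close> suffices.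

  The Erdos--Hajnal property yields a set whose size is only a power of the size \<open>t\<close> of
  the second sample. Therefore \<open>t\<close> is chosen to make this power at least
  \<open>2 * e\<close>, and linear size comes from replacing each point by its cluster. Nothing is
  known about the edges inside a cluster, but with \<open>2 * e\<close> clusters they are too few to
  matter.

  Probabilities appear as counts of functions in \<open>PiE I A\<close>, mostly cleared of
  denominators.\<close>

abbreviation nbrs :: "'v set set \<Rightarrow> 'v \<Rightarrow> 'v set" where
  "nbrs E v \<equiv> {u. {u, v} \<in> E}"

text \<open>The realising vertices \<open>W\<close> and the shattered set \<open>Z\<close> are
  separate arguments because duality exchanges their roles; they may overlap.\<close>

definition shatters :: "'v set set \<Rightarrow> 'v set \<Rightarrow> 'v set \<Rightarrow> bool" where
  "shatters E W Z \<longleftrightarrow> (\<forall>Y\<subseteq>Z. \<exists>w\<in>W. nbrs E w \<inter> Z = Y)"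

lemma shattersE:
  assumes "shatters E W Z" "Y \<subseteq> Z"
  obtains w where "w \<in> W" "nbrs E w \<inter> Z = Y"
  using assms(1)[unfolded shatters_def, rule_format, OF assms(2)] that by (elim bexE)

lemma shatters_subset:
  assumes "shatters E W Z" "Z' \<subseteq> Z"
  shows "shatters E W Z'"
  unfolding shatters_def
proof (intro allI impI)
  fix Y assume "Y \<subseteq> Z'"
  then obtain w where "w \<in> W" "nbrs E w \<inter> Z = Y"
    using shattersE[OF assms(1)] assms(2) by (metis subset_trans)
  with \<open>Y \<subseteq> Z'\<close> assms(2) show "\<exists>w\<in>W. nbrs E w \<inter> Z' = Y"
    by blast
qed

section \<open>Induced subgraphs and isomorphism\<close>

lemma simple_graph_no_loop: "simple_graph G \<Longrightarrow> {v, v} \<notin> edges G"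
  by (auto simp: simple_graph_def nsets_def)

lemma simple_graph_induced:
  assumes "simple_graph G" "X \<subseteq> vertices G"
  shows "simple_graph (induced G X)"
  using assms finite_subset[OF assms(2)] by (auto simp: simple_graph_def induced_def nsets_def)

lemma induced_induced: "Y \<subseteq> X \<Longrightarrow> induced (induced G X) Y = induced G Y"
  by (auto simp: induced_def)

lemma isomorphic_card: "isomorphic (induced G X) F \<Longrightarrow> card X = card (vertices F)"
  by (auto simp: isomorphic_def induced_def dest: bij_betw_same_card)

lemma isomorphic_induced_image:
  assumes inj: "inj_on g (vertices F)"
    and edge: "\<And>u v. u \<in> vertices F \<Longrightarrow> v \<in> vertices F \<Longrightarrow> {u, v} \<in> edges F \<longleftrightarrow> {g u, g v} \<in> edges H"
  shows "isomorphic (induced H (g ` vertices F)) F"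
  unfolding isomorphic_def
proof (intro exI conjI ballI)
  let ?f = "inv_into (vertices F) g"
  show "bij_betw ?f (vertices (induced H (g ` vertices F))) (vertices F)"
    using inj by (simp add: induced_def bij_betw_inv_into inj_on_imp_bij_betw)
  fix x y assume "x \<in> vertices (induced H (g ` vertices F))" "y \<in> vertices (induced H (g ` vertices F))"
  then obtain u v where uv: "u \<in> vertices F" "v \<in> vertices F" "x = g u" "y = g v"
    by (auto simp: induced_def)
  then show "{x, y} \<in> edges (induced H (g ` vertices F)) \<longleftrightarrow> {?f x, ?f y} \<in> edges F"
    using edge[OF uv(1,2)] by (simp add: induced_def inv_into_f_f[OF inj])
qed

section \<open>Duality and Ramsey's theorem for shattered sets\<close>

lemma ramsey_clique_or_indep:
  "\<exists>N\<ge>m. \<forall>(V::'v set) E. finite V \<and> card V \<ge> N \<longrightarrow>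
     (\<exists>R\<subseteq>V. card R = m \<and> (clique R E \<or> indep R E))"
proof -
  obtain r where r: "\<forall>(V::'v set) E. finite V \<and> card V \<ge> r \<longrightarrow>
      (\<exists>R\<subseteq>V. card R = m \<and> clique R E \<or> card R = m \<and> indep R E)"
    using ramsey2[of m m] by blast
  show ?thesis
  proof (intro exI[of _ "max r m"] conjI allI impI)
    fix V :: "'v set" and E assume "finite V \<and> max r m \<le> card V"
    then have "finite V \<and> r \<le> card V" by simp
    with r[rule_format, of V E] show "\<exists>R\<subseteq>V. card R = m \<and> (clique R E \<or> indep R E)" by blast
  qed simp
qed

text \<open>Index \<open>2 ^ r\<close> points of \<open>Z\<close> by the subsets of
  \<open>{..<r}\<close>. A vertex \<open>w i\<close> adjacent to exactly the points whose index
  contains \<open>i\<close> exists by shattering, and then the point indexed by \<open>S\<close>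
  sees precisely the \<open>w i\<close> with \<open>i \<in> S\<close>.\<close>

lemma shatters_dual:
  assumes "shatters E V Z" "finite Z" "2 ^ r \<le> card Z"
  obtains W where "W \<subseteq> V" "finite W" "card W = r" "shatters E Z W"
proof -
  obtain e where e: "inj_on e (Pow {..<r})" "e ` Pow {..<r} \<subseteq> Z"
    using card_le_inj[of "Pow {..<r}" Z] assms(2,3) unfolding card_Pow[OF finite_lessThan] by auto
  have "\<exists>w\<in>V. nbrs E w \<inter> Z = e ` {S \<in> Pow {..<r}. i \<in> S}" for i
    by (rule assms(1)[unfolded shatters_def, rule_format]) (use e(2) in auto)
  then have "\<forall>i. \<exists>w. w \<in> V \<and> nbrs E w \<inter> Z = e ` {S \<in> Pow {..<r}. i \<in> S}"
    unfolding Bex_def by (rule allI)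
  from choice[OF this] obtain w where
    "\<forall>i. w i \<in> V \<and> nbrs E (w i) \<inter> Z = e ` {S \<in> Pow {..<r}. i \<in> S}" ..
  then have w: "\<And>i. w i \<in> V" "\<And>i. nbrs E (w i) \<inter> Z = e ` {S \<in> Pow {..<r}. i \<in> S}"
    by simp_all
  have adj: "{w i, e S} \<in> E \<longleftrightarrow> i \<in> S" if S: "S \<subseteq> {..<r}" for i S
  proof -
    have "e S \<in> Z" using S e(2) by auto
    then have "{w i, e S} \<in> E \<longleftrightarrow> e S \<in> nbrs E (w i) \<inter> Z"
      by (simp add: insert_commute)
    also have "\<dots> \<longleftrightarrow> S \<in> {S \<in> Pow {..<r}. i \<in> S}"
      unfolding w(2) by (rule inj_on_image_mem_iff[OF e(1)]) (use S in auto)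
    finally show ?thesis using S by simp
  qed
  have inj: "inj_on w {..<r}"
  proof (rule inj_onI)
    fix i j assume ij: "i \<in> {..<r}" "j \<in> {..<r}" "w i = w j"
    \<comment> \<open>The point with index \<open>{i}\<close> tells \<open>w i\<close> from every
      other \<open>w j\<close>.\<close>
    have "i \<in> {i} \<longleftrightarrow> j \<in> {i}"
      using adj[of "{i}" i] adj[of "{i}" j] unfolding ij(3) using ij(1) by blast
    then show "i = j" by simp
  qed
  show thesis
  proof (rule that[of "w ` {..<r}"])
    show "shatters E Z (w ` {..<r})"
      unfolding shatters_def
    proof (intro allI impI)
      fix Y assume Y: "Y \<subseteq> w ` {..<r}"
      let ?S = "{i. i < r \<and> w i \<in> Y}"
      have S: "?S \<subseteq> {..<r}" by auto
      have "nbrs E (e ?S) \<inter> w ` {..<r} = Y"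
      proof (intro set_eqI iffI)
        fix x assume "x \<in> nbrs E (e ?S) \<inter> w ` {..<r}"
        then obtain i where "x = w i" "{w i, e ?S} \<in> E" by auto
        with adj[OF S, of i] show "x \<in> Y" by simp
      next
        fix x assume "x \<in> Y"
        with Y obtain i where "x = w i" "i < r" "i \<in> ?S" by auto
        with adj[OF S, of i] show "x \<in> nbrs E (e ?S) \<inter> w ` {..<r}" by simp
      qed
      then show "\<exists>z\<in>Z. nbrs E z \<inter> w ` {..<r} = Y"
        using e(2) by (intro bexI[of _ "e ?S"]) auto
    qed
  qed (use inj w(1) in \<open>auto simp: card_image\<close>)
qed

text \<open>Ramsey's theorem is used on both sides of a dualisation: inside \<open>Z\<close> it
  leaves \<open>2 ^ N\<close> homogeneous points, these shatter some \<open>N\<close> vertices, and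
  inside those it is used again. Both restrictions pass to a subset of the shattered side, so
  shattering survives.\<close>

lemma shattered_homogeneous_pair:
  assumes "2 \<le> r"
  shows "\<exists>D. \<forall>V (Z::'v set) E. finite Z \<and> D \<le> card Z \<and> Z \<subseteq> V \<and> shatters E V Z \<and> (\<forall>v. {v} \<notin> E) \<longrightarrow>
    (\<exists>W0\<subseteq>V. \<exists>Z0\<subseteq>V. finite W0 \<and> card W0 = r \<and> W0 \<inter> Z0 = {} \<and> shatters E Z0 W0 \<and>
       (clique W0 E \<or> indep W0 E) \<and> (clique Z0 E \<or> indep Z0 E))"
proof -
  obtain N where N: "\<forall>(V::'v set) E. finite V \<and> card V \<ge> N \<longrightarrow>
     (\<exists>R\<subseteq>V. card R = r \<and> (clique R E \<or> indep R E))"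
    using ramsey_clique_or_indep by blast
  obtain D where D: "\<forall>(V::'v set) E. finite V \<and> card V \<ge> D \<longrightarrow>
     (\<exists>R\<subseteq>V. card R = 2 ^ N \<and> (clique R E \<or> indep R E))"
    using ramsey_clique_or_indep by blast
  show ?thesis
  proof (intro exI[of _ D] allI impI)
    fix V Z :: "'v set" and E
    assume *: "finite Z \<and> D \<le> card Z \<and> Z \<subseteq> V \<and> shatters E V Z \<and> (\<forall>v. {v} \<notin> E)"
    then obtain Z0 where Z0: "Z0 \<subseteq> Z" "card Z0 = 2 ^ N" "clique Z0 E \<or> indep Z0 E"
      using D by meson
    obtain W where W: "W \<subseteq> V" "finite W" "card W = N" "shatters E Z0 W"
      by (rule shatters_dual[of E V Z0 N]) (use * Z0 in \<open>auto intro: shatters_subset finite_subset\<close>)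
    obtain W0 where W0: "W0 \<subseteq> W" "card W0 = r" "clique W0 E \<or> indep W0 E"
      using N W by (metis order_refl)
    have sh: "shatters E Z0 W0" using W(4) W0(1) by (rule shatters_subset)
    \<comment> \<open>Let \<open>w\<close> lie in both sets. Some \<open>z1\<close> in
      \<open>Z0\<close> sees all of \<open>W0\<close>, in particular \<open>w\<close>, so
      \<open>Z0\<close> is a clique and \<open>w\<close> is the only member of \<open>Z0\<close>
      that does not see \<open>w\<close>. But the members with traces \<open>{}\<close> and
      \<open>{x}\<close> both miss \<open>w\<close>, and they differ. A second point
      \<open>x\<close> of \<open>W0\<close> exists since \<open>2 \<le> r\<close>.\<close>
    have "W0 \<inter> Z0 = {}"
    proof (rule ccontr)
      assume "W0 \<inter> Z0 \<noteq> {}"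
      then obtain w where w: "w \<in> W0" "w \<in> Z0" by blast
      obtain x where x: "x \<in> W0" "x \<noteq> w"
      proof -
        have "W0 \<noteq> {w}" using W0(2) assms by auto
        then show ?thesis using that w(1) by blast
      qed
      obtain z1 where z1: "z1 \<in> Z0" "nbrs E z1 \<inter> W0 = W0" by (rule shattersE[OF sh order_refl])
      obtain z2 where z2: "z2 \<in> Z0" "nbrs E z2 \<inter> W0 = {}" by (rule shattersE[OF sh empty_subsetI])
      obtain z3 where z3: "z3 \<in> Z0" "nbrs E z3 \<inter> W0 = {x}"
        by (rule shattersE[OF sh, of "{x}"]) (use x in auto)
      have "w \<in> nbrs E z1 \<inter> W0" using z1(2) w(1) by simp
      then have "{w, z1} \<in> E" by simp
      moreover have "w \<noteq> z1" using calculation * by auto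
      ultimately have cl: "clique Z0 E" using Z0(3) w(2) z1(1) unfolding indep_def by blast
      have "z = w" if "z \<in> Z0" "w \<notin> nbrs E z \<inter> W0" for z
        using cl that w unfolding clique_def by auto
      from this[of z2] this[of z3] have "z2 = w" "z3 = w"
        unfolding z2(2) z3(2) using z2(1) z3(1) x(2) by simp_all
      then show False using z2(2) z3(2) by simp
    qed
    then show "\<exists>W0\<subseteq>V. \<exists>Z0\<subseteq>V. finite W0 \<and> card W0 = r \<and> W0 \<inter> Z0 = {} \<and> shatters E Z0 W0 \<and>
       (clique W0 E \<or> indep W0 E) \<and> (clique Z0 E \<or> indep Z0 E)"
      using W0 sh Z0 W * by (intro exI[of _ W0] conjI exI[of _ Z0]) (auto intro: finite_subset)
  qed
qed

section \<open>Embedding graphs with two homogeneous parts\<close>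

lemma clique_or_indep_edge_iff:
  assumes "clique P E \<and> clique W E' \<or> indep P E \<and> indep W E'"
    and "u \<in> P" "v \<in> P" "u \<noteq> v" "x \<in> W" "y \<in> W" "x \<noteq> y"
  shows "{u, v} \<in> E \<longleftrightarrow> {x, y} \<in> E'"
  using assms(1)
proof (elim disjE conjE)
  assume "clique P E" "clique W E'"
  with assms(2-) show ?thesis by (simp add: clique_def)
next
  assume "indep P E" "indep W E'"
  with assms(2-) show ?thesis by (simp add: indep_def)
qed

text \<open>Inside the parts adjacency is right automatically, since \<open>W\<close> and
  \<open>Z\<close> are homogeneous of the same kinds as \<open>P\<close> and \<open>Q\<close>.
  Across the parts, \<open>P\<close> is placed in \<open>W\<close> arbitrarily and shattering
  supplies for each \<open>q\<close> a vertex of \<open>Z\<close> with the prescribed trace on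
  \<open>W\<close>. The injection \<open>h\<close> is defined on all of \<open>vertices F\<close>
  because the traces also carry labels of the vertices in \<open>Q\<close>; this explains the bound
  on \<open>card W\<close>.\<close>

lemma embed_two_part_graph:
  assumes F: "simple_graph F" and H: "simple_graph H"
    and parts: "P \<union> Q = vertices F" "P \<inter> Q = {}"
    and WZ: "W \<subseteq> vertices H" "Z \<subseteq> vertices H" "W \<inter> Z = {}" "finite W" "card (vertices F) \<le> card W"
    and sh: "shatters (edges H) Z W"
    and P: "clique P (edges F) \<and> clique W (edges H) \<or> indep P (edges F) \<and> indep W (edges H)"
    and Q: "clique Q (edges F) \<and> clique Z (edges H) \<or> indep Q (edges F) \<and> indep Z (edges H)"
  shows "\<not> induced_free {F} H"
proof -
  have "finite (vertices F)" using F by (simp add: simple_graph_def)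
  then obtain h where h: "inj_on h (vertices F)" "h ` vertices F \<subseteq> W"
    using card_le_inj[of "vertices F" W] WZ by auto
  \<comment> \<open>The point \<open>h q\<close> serves as a label of \<open>q\<close>, making the images of \<open>Q\<close> distinct.\<close>
  define lab where "lab q = h ` ({p \<in> P. {p, q} \<in> edges F} \<union> {q})" for q
  have "lab q \<subseteq> W" if "q \<in> Q" for q
    using h(2) that parts unfolding lab_def by blast
  then have "\<exists>z\<in>Z. nbrs (edges H) z \<inter> W = lab q" if "q \<in> Q" for q
    using sh that unfolding shatters_def by blast
  then have "\<forall>q\<in>Q. \<exists>z. z \<in> Z \<and> nbrs (edges H) z \<inter> W = lab q"
    unfolding Bex_def by (rule ballI)
  from bchoice[OF this] obtain z where
    "\<forall>q\<in>Q. z q \<in> Z \<and> nbrs (edges H) (z q) \<inter> W = lab q" ..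
  then have z: "\<And>q. q \<in> Q \<Longrightarrow> z q \<in> Z" "\<And>q. q \<in> Q \<Longrightarrow> nbrs (edges H) (z q) \<inter> W = lab q"
    by simp_all
  have hP: "h p \<in> W" if "p \<in> P" for p using that parts h by blast
  have PQ: "{h p, z q} \<in> edges H \<longleftrightarrow> {p, q} \<in> edges F" if "p \<in> P" "q \<in> Q" for p q
  proof -
    have "{h p, z q} \<in> edges H \<longleftrightarrow> h p \<in> lab q"
      using z(2)[OF that(2)] hP[OF that(1)] by blast
    also have "\<dots> \<longleftrightarrow> p \<in> {p \<in> P. {p, q} \<in> edges F} \<union> {q}"
      unfolding lab_def
      by (rule inj_on_image_mem_iff[OF h(1)]) (use that parts in auto)
    finally show ?thesis using that parts(2) by auto
  qed
  have zinj: "q = q'" if "q \<in> Q" "q' \<in> Q" "z q = z q'" for q q'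
  proof -
    have "h q \<in> lab q" by (simp add: lab_def)
    then have "h q \<in> lab q'" using z(2)[OF that(1)] z(2)[OF that(2)] that(3) by simp
    then have "q \<in> {p \<in> P. {p, q'} \<in> edges F} \<union> {q'}"
      unfolding lab_def
      by (subst (asm) inj_on_image_mem_iff[OF h(1)]) (use that parts in auto)
    then show ?thesis using that parts by auto
  qed
  define g where "g v = (if v \<in> P then h v else z v)" for v
  have gP: "g p = h p" if "p \<in> P" for p using that by (simp add: g_def)
  have gQ: "g q = z q" if "q \<in> Q" for q using that parts(2) by (auto simp: g_def)
  have hinj: "p = p'" if "p \<in> P" "p' \<in> P" "h p = h p'" for p p'
    using that h(1) parts(1) by (auto simp: inj_on_def)
  have inj: "inj_on g (vertices F)"
  proof (rule inj_onI)
    fix u v assume uv: "u \<in> vertices F" "v \<in> vertices F" "g u = g v"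
    have hz: "h p \<noteq> z q" if "p \<in> P" "q \<in> Q" for p q
      using hP[OF that(1)] z(1)[OF that(2)] WZ(3) by auto
    have "u \<in> P \<union> Q" "v \<in> P \<union> Q" unfolding parts(1) by (fact uv)+
    then consider "u \<in> P" "v \<in> P" | "u \<in> Q" "v \<in> Q" | "u \<in> P" "v \<in> Q" | "u \<in> Q" "v \<in> P"
      by (elim UnE)
    then show "u = v"
    proof cases
      case 1 then show ?thesis using uv(3) hinj by (simp add: gP)
    next
      case 2 then show ?thesis using uv(3) zinj by (simp add: gQ)
    next
      case 3 then show ?thesis using uv(3) hz[OF 3] by (simp add: gP gQ)
    next
      case 4 then show ?thesis using uv(3) hz[OF 4(2,1)] by (simp add: gP gQ)
    qed
  qed
  have edge: "{u, v} \<in> edges F \<longleftrightarrow> {g u, g v} \<in> edges H" if "u \<in> vertices F" "v \<in> vertices F" for u v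
  proof (cases "u = v")
    case True
    then show ?thesis using simple_graph_no_loop[OF F] simple_graph_no_loop[OF H] by auto
  next
    case False
    then have "g u \<noteq> g v" using inj that by (auto simp: inj_on_def)
    have "u \<in> P \<union> Q" "v \<in> P \<union> Q" unfolding parts(1) by (fact that)+
    then consider "u \<in> P" "v \<in> P" | "u \<in> Q" "v \<in> Q" | "u \<in> P" "v \<in> Q" | "u \<in> Q" "v \<in> P"
      by (elim UnE)
    then show ?thesis
    proof cases
      case 1
      then show ?thesis
        using clique_or_indep_edge_iff[OF P 1 False hP[OF 1(1)] hP[OF 1(2)]] \<open>g u \<noteq> g v\<close>
        by (simp add: gP)
    next
      case 2
      then show ?thesis
        using clique_or_indep_edge_iff[OF Q 2 False z(1)[OF 2(1)] z(1)[OF 2(2)]] \<open>g u \<noteq> g v\<close>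
        by (simp add: gQ)
    next
      case 3
      then show ?thesis using PQ by (simp add: gP gQ)
    next
      case 4
      then show ?thesis using PQ[of v u] by (simp add: gP gQ insert_commute)
    qed
  qed
  have "g ` vertices F \<subseteq> vertices H"
  proof (rule image_subsetI)
    fix v assume "v \<in> vertices F"
    then have "v \<in> P \<union> Q" unfolding parts(1) .
    then consider "v \<in> P" | "v \<in> Q" by (elim UnE)
    then show "g v \<in> vertices H"
      using hP z(1) WZ(1,2) by cases (auto simp: gP gQ)
  qed
  moreover have "isomorphic (induced H (g ` vertices F)) F"
    by (rule isomorphic_induced_image[OF inj edge])
  ultimately show ?thesis
    unfolding induced_free_def by (simp, intro exI conjI)
qed

lemma indep_complement_imp_clique:
  assumes "indep A ([V]\<^bsup>2\<^esup> - E)" "A \<subseteq> V"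
  shows "clique A E"
  unfolding clique_def
proof (intro ballI impI)
  fix v w assume vw: "v \<in> A" "w \<in> A" "v \<noteq> w"
  then have "{v, w} \<notin> [V]\<^bsup>2\<^esup> - E" using assms(1) by (simp add: indep_def)
  then show "{v, w} \<in> E" using vw subsetD[OF assms(2)] by simp
qed

lemma cobipartite_cliques:
  assumes "cobipartite F"
  obtains A B where "A \<union> B = vertices F" "A \<inter> B = {}" "clique A (edges F)" "clique B (edges F)"
proof -
  obtain A B where AB: "A \<union> B = vertices F" "A \<inter> B = {}"
    "indep A ([vertices F]\<^bsup>2\<^esup> - edges F)" "indep B ([vertices F]\<^bsup>2\<^esup> - edges F)"
    using assms by (auto simp: cobipartite_def bipartite_def complement_def)
  have "A \<subseteq> vertices F" "B \<subseteq> vertices F" using AB(1) by auto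
  then show thesis
    using that AB indep_complement_imp_clique by metis
qed

text \<open>A homogeneous shattered pair shows one of four patterns. Two cliques contain the
  co-bipartite member, two independent sets the bipartite one, and both mixed patterns contain the
  split member, with its two parts exchanged in one of them.\<close>

lemma bounded_shattering:
  assumes simple: "\<forall>F\<in>\<F>. simple_graph F"
    and bip: "\<exists>F\<in>\<F>. bipartite F"
    and cobip: "\<exists>F\<in>\<F>. cobipartite F"
    and split: "\<exists>F\<in>\<F>. split_graph F"
  shows "\<exists>D. \<forall>(H::'v ugraph) Z. simple_graph H \<and> Z \<subseteq> vertices H \<and> D \<le> card Z \<and>
    shatters (edges H) (vertices H) Z \<longrightarrow> \<not> induced_free \<F> H"
proof -
  obtain F1 A1 B1 where F1: "F1 \<in> \<F>" "A1 \<union> B1 = vertices F1" "A1 \<inter> B1 = {}"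
      "indep A1 (edges F1)" "indep B1 (edges F1)"
    using bip unfolding bipartite_def by blast
  obtain F2 A2 B2 where F2: "F2 \<in> \<F>" "A2 \<union> B2 = vertices F2" "A2 \<inter> B2 = {}"
      "clique A2 (edges F2)" "clique B2 (edges F2)"
    using cobip cobipartite_cliques by metis
  obtain F3 A3 B3 where F3: "F3 \<in> \<F>" "A3 \<union> B3 = vertices F3" "A3 \<inter> B3 = {}"
      "clique A3 (edges F3)" "indep B3 (edges F3)"
    using split unfolding split_graph_def by blast
  \<comment> \<open>The summand 2 meets the size condition of
    \<open>shattered_homogeneous_pair\<close>; the others make room in \<open>W0\<close> for
    whichever of the three graphs is embedded.\<close>
  let ?r = "2 + card (vertices F1) + card (vertices F2) + card (vertices F3)"
  have "2 \<le> ?r" by simp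
  from shattered_homogeneous_pair[OF this] obtain D where D: "\<forall>V (Z::'v set) E. finite Z \<and> D \<le> card Z \<and> Z \<subseteq> V \<and> shatters E V Z \<and> (\<forall>v. {v} \<notin> E) \<longrightarrow>
    (\<exists>W0\<subseteq>V. \<exists>Z0\<subseteq>V. finite W0 \<and> card W0 = ?r \<and> W0 \<inter> Z0 = {} \<and> shatters E Z0 W0 \<and>
       (clique W0 E \<or> indep W0 E) \<and> (clique Z0 E \<or> indep Z0 E))"
    by (rule exE)
  show ?thesis
  proof (intro exI[of _ D] allI impI)
    fix H :: "'v ugraph" and Z
    assume *: "simple_graph H \<and> Z \<subseteq> vertices H \<and> D \<le> card Z \<and> shatters (edges H) (vertices H) Z"
    then have H: "simple_graph H" by simp
    have "\<exists>W0\<subseteq>vertices H. \<exists>Z0\<subseteq>vertices H. finite W0 \<and> card W0 = ?r \<and> W0 \<inter> Z0 = {} \<and>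
       shatters (edges H) Z0 W0 \<and> (clique W0 (edges H) \<or> indep W0 (edges H)) \<and> (clique Z0 (edges H) \<or> indep Z0 (edges H))"
      by (rule D[rule_format, of Z])
        (use * simple_graph_no_loop[OF H] in \<open>auto simp: simple_graph_def intro: finite_subset\<close>)
    then obtain W0 Z0 where WZ: "W0 \<subseteq> vertices H" "Z0 \<subseteq> vertices H" "W0 \<inter> Z0 = {}" "finite W0" "card W0 = ?r"
      "shatters (edges H) Z0 W0" "clique W0 (edges H) \<or> indep W0 (edges H)" "clique Z0 (edges H) \<or> indep Z0 (edges H)"
      by blast
    have emb: "\<not> induced_free {F} H" if "F \<in> \<F>" "P \<union> Q = vertices F" "P \<inter> Q = {}" "card (vertices F) \<le> ?r"
      "clique P (edges F) \<and> clique W0 (edges H) \<or> indep P (edges F) \<and> indep W0 (edges H)"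
      "clique Q (edges F) \<and> clique Z0 (edges H) \<or> indep Q (edges F) \<and> indep Z0 (edges H)" for F P Q
      by (rule embed_two_part_graph[of F H P Q W0 Z0]) (use that simple H WZ in auto)
    have "\<exists>F\<in>\<F>. \<not> induced_free {F} H"
      using WZ(7,8)
    proof (elim disjE)
      assume "clique W0 (edges H)" "clique Z0 (edges H)"
      then show ?thesis using emb[OF F2(1,2,3)] F2 by auto
    next
      assume "clique W0 (edges H)" "indep Z0 (edges H)"
      then show ?thesis using emb[OF F3(1,2,3)] F3 by auto
    next
      assume "indep W0 (edges H)" "clique Z0 (edges H)"
      then show ?thesis using emb[of F3 B3 A3] F3 by (auto simp: Un_commute Int_commute)
    next
      assume "indep W0 (edges H)" "indep Z0 (edges H)"
      then show ?thesis using emb[OF F1(1,2,3)] F1 by auto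
    qed
    then show "\<not> induced_free \<F> H" by (auto simp: induced_free_def)
  qed
qed

section \<open>The Sauer--Shelah lemma\<close>

text \<open>The counterpart of \<open>shatters\<close> for set systems, to be applied to traces of
  neighbourhoods.\<close>

definition shattered :: "'a set set \<Rightarrow> 'a set \<Rightarrow> bool" where
  "shattered \<T> Z \<longleftrightarrow> (\<forall>Y\<subseteq>Z. \<exists>S\<in>\<T>. S \<inter> Z = Y)"

lemma shatteredI:
  assumes "\<And>Y. Y \<subseteq> Z \<Longrightarrow> \<exists>S\<in>\<T>. S \<inter> Z = Y"
  shows "shattered \<T> Z"
  unfolding shattered_def using assms by (intro allI impI)

lemma shatteredE:
  assumes "shattered \<T> Z" "Y \<subseteq> Z"
  obtains S where "S \<in> \<T>" "S \<inter> Z = Y"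
  using assms(1)[unfolded shattered_def, rule_format, OF assms(2)] that by (elim bexE)

text \<open>Pajor's form of the Sauer--Shelah lemma. Split the family into the sets avoiding
  \<open>a\<close> and the sets containing it, with \<open>a\<close> removed from the latter. What
  either half shatters is shattered by the whole, and what both halves shatter pays a second time,
  with \<open>a\<close> adjoined.\<close>

lemma card_le_card_shattered:
  assumes "finite T" "\<T> \<subseteq> Pow T"
  shows "card \<T> \<le> card {Z \<in> Pow T. shattered \<T> Z}"
  using assms
proof (induction T arbitrary: \<T> rule: finite_induct)
  case empty
  then consider "\<T> = {}" | "\<T> = {{}}" by auto
  then show ?case
  proof cases
    case 2
    then have "{Z \<in> Pow {}. shattered \<T> Z} = {{}}" by (auto simp: shattered_def)
    with 2 show ?thesis by simp
  qed simp
next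
  case (insert a T)
  define A where "A = {S \<in> \<T>. a \<notin> S}"
  define B where "B = {S. a \<notin> S \<and> insert a S \<in> \<T>}"
  let ?Sh = "\<lambda>\<T>. {Z \<in> Pow T. shattered \<T> Z}"
  have AT: "A \<subseteq> Pow T" using insert.prems by (auto simp: A_def)
  have BT: "B \<subseteq> Pow T" using insert.prems by (auto simp: B_def)
  have fin: "finite A" "finite B" "finite (?Sh A)" "finite (?Sh B)"
    using finite_subset[OF AT] finite_subset[OF BT] insert.hyps(1) by auto
  have "\<T> = A \<union> insert a ` B"
  proof (intro subset_antisym subsetI)
    fix S assume "S \<in> \<T>"
    show "S \<in> A \<union> insert a ` B"
    proof (cases "a \<in> S")
      case True
      then have "insert a (S - {a}) = S" by auto
      with \<open>S \<in> \<T>\<close> have "S - {a} \<in> B" by (simp add: B_def)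
      with \<open>insert a (S - {a}) = S\<close> show ?thesis by (metis UnI2 image_eqI)
    qed (use \<open>S \<in> \<T>\<close> in \<open>simp add: A_def\<close>)
  qed (auto simp: A_def B_def)
  moreover have "card (insert a ` B) = card B"
  proof (intro card_image inj_onI)
    fix x y assume "x \<in> B" "y \<in> B" "insert a x = insert a y"
    then show "x = y" by (simp add: B_def insert_ident)
  qed
  moreover have "A \<inter> insert a ` B = {}" by (auto simp: A_def)
  ultimately have "card \<T> = card A + card B"
    using fin by (simp add: card_Un_disjoint)
  also have "\<dots> \<le> card (?Sh A) + card (?Sh B)"
    using insert.IH[OF AT] insert.IH[OF BT] by (rule add_mono)
  also have "\<dots> = card (?Sh A \<union> ?Sh B) + card (insert a ` (?Sh A \<inter> ?Sh B))"
  proof -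
    have "inj_on (insert a) (?Sh A \<inter> ?Sh B)"
    proof (rule inj_onI)
      fix x y assume "x \<in> ?Sh A \<inter> ?Sh B" "y \<in> ?Sh A \<inter> ?Sh B" and eq: "insert a x = insert a y"
      then have "x \<subseteq> T" "y \<subseteq> T" by simp_all
      then have "a \<notin> x" "a \<notin> y" using insert.hyps(2) by auto
      then show "x = y" using eq by (simp add: insert_ident)
    qed
    then show ?thesis using card_Un_Int[OF fin(3,4)] by (simp add: card_image)
  qed
  also have "\<dots> = card ((?Sh A \<union> ?Sh B) \<union> insert a ` (?Sh A \<inter> ?Sh B))"
    by (rule card_Un_disjoint[symmetric]) (use fin insert.hyps(2) in auto)
  also have "\<dots> \<le> card {Z \<in> Pow (insert a T). shattered \<T> Z}"
  proof (rule card_mono)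
    show "finite {Z \<in> Pow (insert a T). shattered \<T> Z}" using insert.hyps(1) by simp
    have SA: "shattered \<T> Z" if Z: "Z \<in> ?Sh A" for Z
    proof (rule shatteredI)
      fix Y assume "Y \<subseteq> Z"
      have "shattered A Z" using Z by simp
      then obtain S where "S \<in> A" "S \<inter> Z = Y" using \<open>Y \<subseteq> Z\<close> by (rule shatteredE)
      then show "\<exists>S\<in>\<T>. S \<inter> Z = Y" by (auto simp: A_def)
    qed
    have SB: "\<exists>S\<in>\<T>. a \<in> S \<and> S \<inter> Z = Y" if Z: "Z \<in> ?Sh B" and Y: "Y \<subseteq> Z" for Z Y
    proof -
      have "shattered B Z" using Z by simp
      then obtain S where "S \<in> B" "S \<inter> Z = Y" using Y by (rule shatteredE)
      moreover have "a \<notin> Z" using Z insert.hyps(2) by auto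
      ultimately show ?thesis by (intro bexI[of _ "insert a S"]) (auto simp: B_def)
    qed
    have SAB: "shattered \<T> (insert a Z)" if Z: "Z \<in> ?Sh A" "Z \<in> ?Sh B" for Z
    proof (rule shatteredI)
      fix Y assume Y: "Y \<subseteq> insert a Z"
      have "a \<notin> Z" using Z insert.hyps(2) by auto
      show "\<exists>S\<in>\<T>. S \<inter> insert a Z = Y"
      proof (cases "a \<in> Y")
        case True
        have "Y - {a} \<subseteq> Z" using Y by auto
        from SB[OF Z(2) this] obtain S where "S \<in> \<T>" "a \<in> S" "S \<inter> Z = Y - {a}" by (elim bexE conjE)
        then show ?thesis using True by (intro bexI[of _ S]) auto
      next
        case False
        with Y have "Y \<subseteq> Z" by auto
        have "shattered A Z" using Z(1) by simp
        then obtain S where "S \<in> A" "S \<inter> Z = Y" using \<open>Y \<subseteq> Z\<close> by (rule shatteredE)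
        then show ?thesis using False by (intro bexI[of _ S]) (auto simp: A_def)
      qed
    qed
    show "(?Sh A \<union> ?Sh B) \<union> insert a ` (?Sh A \<inter> ?Sh B) \<subseteq> {Z \<in> Pow (insert a T). shattered \<T> Z}"
    proof (intro Un_least subsetI)
      fix Z assume "Z \<in> ?Sh A"
      then show "Z \<in> {Z \<in> Pow (insert a T). shattered \<T> Z}" using SA by auto
    next
      fix Z assume Z: "Z \<in> ?Sh B"
      have "shattered \<T> Z"
      proof (rule shatteredI)
        fix Y assume "Y \<subseteq> Z"
        from SB[OF Z this] show "\<exists>S\<in>\<T>. S \<inter> Z = Y" by (elim bexE conjE) (rule bexI)
      qed
      with Z show "Z \<in> {Z \<in> Pow (insert a T). shattered \<T> Z}" by auto
    next
      fix Z assume "Z \<in> insert a ` (?Sh A \<inter> ?Sh B)"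
      then obtain Z' where Z': "Z = insert a Z'" "Z' \<in> ?Sh A" "Z' \<in> ?Sh B" by auto
      have "shattered \<T> Z" unfolding Z'(1) using SAB[OF Z'(2,3)] .
      with Z' show "Z \<in> {Z \<in> Pow (insert a T). shattered \<T> Z}" by auto
    qed
  qed
  finally show ?case .
qed

text \<open>A crude estimate of the binomial sum; only polynomial growth in \<open>N\<close> matters
  later.\<close>

lemma card_small_subsets:
  assumes "finite T" "card T \<le> N" "1 \<le> N"
  shows "card {Z \<in> Pow T. card Z < D} \<le> D * N ^ D"
proof -
  have "{Z \<in> Pow T. card Z < D} \<subseteq> (\<Union>i<D. {Z. Z \<subseteq> T \<and> card Z = i})" by auto
  then have "card {Z \<in> Pow T. card Z < D} \<le> card (\<Union>i<D. {Z. Z \<subseteq> T \<and> card Z = i})"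
    by (rule card_mono[rotated]) (use assms(1) in auto)
  also have "\<dots> \<le> (\<Sum>i<D. card {Z. Z \<subseteq> T \<and> card Z = i})" by (rule card_UN_le) simp
  also have "\<dots> \<le> (\<Sum>i<D. N ^ D)"
  proof (rule sum_mono)
    fix i assume "i \<in> {..<D}"
    have "card {Z. Z \<subseteq> T \<and> card Z = i} = card T choose i"
      using n_subsets[OF assms(1)] by simp
    also have "\<dots> \<le> card T ^ i"
      by (cases "i \<le> card T") (auto simp: binomial_le_pow binomial_eq_0)
    also have "\<dots> \<le> N ^ i" using assms(2) by (rule power_mono) simp
    also have "\<dots> \<le> N ^ D" using assms(3) \<open>i \<in> {..<D}\<close> by (intro power_increasing) auto
    finally show "card {Z. Z \<subseteq> T \<and> card Z = i} \<le> N ^ D" .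
  qed
  finally show ?thesis by simp
qed

lemma sauer_shelah:
  assumes "finite T" "card T \<le> N" "1 \<le> N" "\<T> \<subseteq> Pow T" "D * N ^ D < card \<T>"
  obtains Z where "Z \<subseteq> T" "D \<le> card Z" "shattered \<T> Z"
proof (rule ccontr)
  assume no: "\<not> thesis"
  have "card \<T> \<le> card {Z \<in> Pow T. shattered \<T> Z}"
    by (rule card_le_card_shattered[OF assms(1,4)])
  also have "\<dots> \<le> card {Z \<in> Pow T. card Z < D}"
  proof (rule card_mono)
    show "{Z \<in> Pow T. shattered \<T> Z} \<subseteq> {Z \<in> Pow T. card Z < D}"
    proof
      fix Z assume "Z \<in> {Z \<in> Pow T. shattered \<T> Z}"
      then have Z: "Z \<subseteq> T" "shattered \<T> Z" by simp_all
      with no that have "\<not> D \<le> card Z" by meson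
      with Z show "Z \<in> {Z \<in> Pow T. card Z < D}" by simp
    qed
  qed (use assms(1) in simp)
  also have "\<dots> \<le> D * N ^ D" by (rule card_small_subsets[OF assms(1-3)])
  finally show False using assms(5) by simp
qed

section \<open>Random samples\<close>

text \<open>A uniform \<open>f\<close> in \<open>PiE I A\<close> is a sample with independent
  coordinates. Conditioned on the values at \<open>a\<close> and \<open>b\<close>, the coordinates
  in \<open>T\<close> land in their targets independently, each with probability at most
  \<open>\<rho>\<close>.\<close>

lemma card_PiE_pair_event:
  fixes A :: "'i \<Rightarrow> 'v set" and \<rho> :: real
  assumes I: "finite I" "a \<in> I" "b \<in> I" "a \<noteq> b" "T \<subseteq> I - {a, b}"
    and A: "\<And>i. i \<in> I \<Longrightarrow> finite (A i)"
    and R: "R \<subseteq> A a \<times> A b"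
    and D: "\<And>x y i. (x, y) \<in> R \<Longrightarrow> i \<in> T \<Longrightarrow> real (card (A i \<inter> D x y)) \<le> \<rho> * real (card (A i))"
    and "0 \<le> \<rho>"
  shows "real (card {f \<in> PiE I A. (f a, f b) \<in> R \<and> (\<forall>i\<in>T. f i \<in> D (f a) (f b))}) * (real (card (A a)) * real (card (A b)))
    \<le> real (card R) * \<rho> ^ card T * real (card (PiE I A))"
proof -
  let ?S = "{f \<in> PiE I A. (f a, f b) \<in> R \<and> (\<forall>i\<in>T. f i \<in> D (f a) (f b))}"
  \<comment> \<open>Once the pair \<open>p\<close> is fixed, the event is again a product, with
    factors \<open>B p i\<close>.\<close>
  define B where "B p i = (if i = a then {fst p} else if i = b then {snd p}
      else if i \<in> T then A i \<inter> D (fst p) (snd p) else A i)" for p :: "'v \<times> 'v" and i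
  define J where "J = I - {a, b}"
  have I_eq: "I = insert a (insert b J)" "a \<notin> insert b J" "b \<notin> J" "finite J"
    using I by (auto simp: J_def)
  have finR: "finite R" by (rule finite_subset[OF R]) (simp add: A I(2,3))
  have finB: "finite (PiE I (B p))" for p
    by (rule finite_PiE[OF I(1)]) (use A in \<open>auto simp: B_def\<close>)
  define M where "M = (\<Prod>i\<in>J. real (card (A i)))"
  have card_B: "real (card (PiE I (B p))) \<le> \<rho> ^ card T * M" if p: "p \<in> R" for p
  proof -
    have "real (card (PiE I (B p))) = (\<Prod>i\<in>I. real (card (B p i)))"
      by (simp add: card_PiE[OF I(1)])
    also have "\<dots> = (\<Prod>i\<in>J. real (card (B p i)))"
      using I_eq(2-4) unfolding I_eq(1) by (simp add: B_def)
    also have "\<dots> \<le> (\<Prod>i\<in>J. (if i \<in> T then \<rho> else 1) * real (card (A i)))"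
    proof (intro prod_mono conjI)
      fix i assume i: "i \<in> J"
      show "real (card (B p i)) \<le> (if i \<in> T then \<rho> else 1) * real (card (A i))"
        using D[of "fst p" "snd p" i] p i by (simp add: B_def J_def)
    qed simp
    also have "\<dots> = (\<Prod>i\<in>J. if i \<in> T then \<rho> else 1) * M"
      by (simp add: prod.distrib M_def)
    also have "(\<Prod>i\<in>J. if i \<in> T then \<rho> else 1) = \<rho> ^ card T"
      using I(5) I_eq(4) by (simp add: prod.If_cases J_def Int_absorb1)
    finally show ?thesis .
  qed
  have "?S \<subseteq> (\<Union>p\<in>R. PiE I (B p))"
  proof
    fix f assume f: "f \<in> ?S"
    then have "f \<in> PiE I (B (f a, f b))" by (simp add: B_def PiE_iff)
    with f show "f \<in> (\<Union>p\<in>R. PiE I (B p))" by auto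
  qed
  then have "card ?S \<le> card (\<Union>p\<in>R. PiE I (B p))"
    by (rule card_mono[rotated]) (use finR finB in auto)
  also have "\<dots> \<le> (\<Sum>p\<in>R. card (PiE I (B p)))" by (rule card_UN_le[OF finR])
  finally have "real (card ?S) \<le> real (\<Sum>p\<in>R. card (PiE I (B p)))"
    by (rule of_nat_mono)
  also have "\<dots> = (\<Sum>p\<in>R. real (card (PiE I (B p))))" by (rule of_nat_sum)
  also have "\<dots> \<le> (\<Sum>p\<in>R. \<rho> ^ card T * M)"
    by (rule sum_mono) (rule card_B)
  finally have "real (card ?S) * (real (card (A a)) * real (card (A b)))
      \<le> real (card R) * (\<rho> ^ card T * M) * (real (card (A a)) * real (card (A b)))"
    by (intro mult_right_mono) auto
  also have "\<dots> = real (card R) * \<rho> ^ card T * real (card (PiE I A))"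
  proof -
    have "real (card (PiE I A)) = (\<Prod>i\<in>I. real (card (A i)))" by (simp add: card_PiE[OF I(1)])
    also have "\<dots> = real (card (A a)) * (real (card (A b)) * M)"
      unfolding I_eq(1) M_def using I_eq(2-4) by simp
    finally show ?thesis by simp
  qed
  finally show ?thesis .
qed

text \<open>A union bound over the injections \<open>p\<close> assigning to each point of
  \<open>X\<close> the coordinate that takes it. There are at most \<open>card I ^ card X\<close> of
  them, and each prescribed coordinate costs a factor of at most \<open>2 / n\<close> because
  \<open>A i\<close> has at least \<open>n / 2\<close> elements.\<close>

lemma card_PiE_image_superset:
  fixes A :: "'i \<Rightarrow> 'v set"
  assumes I: "finite I"
    and A: "\<And>i. i \<in> I \<Longrightarrow> finite (A i)" "\<And>i. i \<in> I \<Longrightarrow> n \<le> 2 * card (A i)"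
    and X: "finite X"
  shows "n ^ card X * card {f \<in> PiE I A. X \<subseteq> f ` I} \<le> (2 * card I) ^ card X * card (PiE I A)"
proof -
  let ?S = "{f \<in> PiE I A. X \<subseteq> f ` I}"
  let ?P = "{p \<in> PiE X (\<lambda>_. I). inj_on p X}"
  define B where "B p i = (if i \<in> p ` X then {inv_into X p i} else A i)" for p :: "'v \<Rightarrow> 'i" and i
  have finP: "finite ?P" using finite_PiE[OF X, of "\<lambda>_. I"] I by simp
  have finB: "finite (PiE I (B p))" for p
    by (rule finite_PiE[OF I]) (use A in \<open>auto simp: B_def\<close>)
  have card_B: "n ^ card X * card (PiE I (B p)) \<le> 2 ^ card X * card (PiE I A)" if p: "p \<in> ?P" for p
  proof -
    have sub: "p ` X \<subseteq> I" using p by (auto simp: PiE_iff)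
    have cardX: "card (p ` X) = card X" using p by (simp add: card_image)
    have split: "(\<Prod>i\<in>I. h i) = (\<Prod>i\<in>I - p ` X. h i) * (\<Prod>i\<in>p ` X. h i)" for h :: "'i \<Rightarrow> nat"
      by (rule prod.subset_diff[OF sub I])
    have "card (PiE I (B p)) = (\<Prod>i\<in>I - p ` X. card (A i))"
      unfolding card_PiE[OF I] split by (simp add: B_def)
    moreover have "n ^ card X \<le> (\<Prod>i\<in>p ` X. 2 * card (A i))"
    proof -
      have "n ^ card X = (\<Prod>i\<in>p ` X. n)" by (simp add: cardX)
      also have "\<dots> \<le> (\<Prod>i\<in>p ` X. 2 * card (A i))"
        using A(2) sub by (intro prod_mono) auto
      finally show ?thesis .
    qed
    moreover have "(\<Prod>i\<in>p ` X. 2 * card (A i)) = 2 ^ card X * (\<Prod>i\<in>p ` X. card (A i))"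
      by (simp add: prod.distrib cardX)
    ultimately have "n ^ card X * card (PiE I (B p))
        \<le> 2 ^ card X * (\<Prod>i\<in>p ` X. card (A i)) * (\<Prod>i\<in>I - p ` X. card (A i))"
      by (metis mult_le_mono1)
    then show ?thesis unfolding card_PiE[OF I] split[of "\<lambda>i. card (A i)"] by (simp add: ac_simps)
  qed
  have "?S \<subseteq> (\<Union>p\<in>?P. PiE I (B p))"
  proof
    fix f assume f: "f \<in> ?S"
    define p where "p = restrict (inv_into I f) X"
    have p: "p x \<in> I" "f (p x) = x" if "x \<in> X" for x
    proof -
      have "x \<in> f ` I" using f that by auto
      then show "p x \<in> I" "f (p x) = x"
        using that by (simp_all add: p_def inv_into_into f_inv_into_f)
    qed
    have inj: "inj_on p X" by (rule inj_on_inverseI[of X f]) (rule p(2))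
    have "p \<in> PiE X (\<lambda>_. I)" using p(1) by (simp add: p_def PiE_iff extensional_def)
    moreover have "f \<in> PiE I (B p)"
      unfolding PiE_iff
    proof (intro conjI ballI)
      fix i assume i: "i \<in> I"
      show "f i \<in> B p i"
      proof (cases "i \<in> p ` X")
        case True
        then obtain x where "x \<in> X" "i = p x" by (rule imageE)
        then show ?thesis using inj p(2) by (simp add: B_def)
      next
        case False
        then show ?thesis using f i by (auto simp: B_def PiE_iff)
      qed
    qed (use f in \<open>simp add: PiE_iff\<close>)
    ultimately show "f \<in> (\<Union>p\<in>?P. PiE I (B p))" using inj by (intro UN_I[of p]) auto
  qed
  then have "card ?S \<le> card (\<Union>p\<in>?P. PiE I (B p))"
    by (rule card_mono[rotated]) (use finP finB in auto)
  also have "\<dots> \<le> (\<Sum>p\<in>?P. card (PiE I (B p)))" by (rule card_UN_le[OF finP])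
  finally have "n ^ card X * card ?S \<le> (\<Sum>p\<in>?P. n ^ card X * card (PiE I (B p)))"
    by (simp add: sum_distrib_left[symmetric])
  also have "\<dots> \<le> (\<Sum>p\<in>?P. 2 ^ card X * card (PiE I A))"
    by (rule sum_mono) (rule card_B)
  also have "\<dots> = card ?P * (2 ^ card X * card (PiE I A))" by simp
  also have "\<dots> \<le> card I ^ card X * (2 ^ card X * card (PiE I A))"
  proof (rule mult_le_mono1)
    have "card ?P \<le> card (PiE X (\<lambda>_. I))"
      by (rule card_mono) (use finite_PiE[OF X, of "\<lambda>_. I"] I in auto)
    then show "card ?P \<le> card I ^ card X" by (simp add: card_PiE[OF X])
  qed
  finally show ?thesis by (simp add: power_mult_distrib ac_simps)
qed

lemma not_induced_freeE:
  assumes "\<not> induced_free \<F> G"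
  obtains X F where "X \<subseteq> vertices G" "F \<in> \<F>" "isomorphic (induced G X) F"
  using assms unfolding induced_free_def by metis

text \<open>First moment: a member of order \<open>j\<close> has at most
  \<open>\<delta> * n ^ j\<close> copies, and each is caught with probability at most
  \<open>(2 * card I / n) ^ j\<close>. The powers of \<open>n\<close> cancel, so the demand on
  \<open>\<delta>\<close> involves only the sample size; each member receives the share
  \<open>1 / (4 * card \<F>)\<close>.\<close>

lemma card_PiE_not_induced_free:
  fixes G :: "'v ugraph" and \<delta> :: real
  assumes G: "finite (vertices G)" "vertices G \<noteq> {}" and \<F>: "finite \<F>"
    and I: "finite I" "\<And>i. i \<in> I \<Longrightarrow> A i \<subseteq> vertices G"
      "\<And>i. i \<in> I \<Longrightarrow> card (vertices G) \<le> 2 * card (A i)"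
    and few: "\<And>F. F \<in> \<F> \<Longrightarrow> real (card (induced_copies F G)) \<le> \<delta> * real (card (vertices G)) ^ card (vertices F)"
    and \<delta>: "\<And>F. F \<in> \<F> \<Longrightarrow> real (card \<F>) * (4 * \<delta> * real (2 * card I) ^ card (vertices F)) \<le> 1"
  shows "4 * real (card {f \<in> PiE I A. \<not> induced_free \<F> (induced G (f ` I))}) \<le> real (card (PiE I A))"
proof -
  let ?\<Omega> = "real (card (PiE I A))" and ?n = "real (card (vertices G))"
  let ?S = "{f \<in> PiE I A. \<not> induced_free \<F> (induced G (f ` I))}"
  let ?E = "\<lambda>X. {f \<in> PiE I A. X \<subseteq> f ` I}"
  have finA: "finite (A i)" if "i \<in> I" for i using I(2)[OF that] G(1) finite_subset by auto
  have fin\<Omega>: "finite (PiE I A)" by (rule finite_PiE[OF I(1) finA])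
  have fincop: "finite (induced_copies F G)" for F :: "'f ugraph"
    by (rule finite_subset[of _ "Pow (vertices G)"]) (use G(1) in \<open>auto simp: induced_copies_def\<close>)
  have n: "?n > 0" using G by (simp add: card_gt_0_iff)
  have "?S \<subseteq> (\<Union>F\<in>\<F>. \<Union>X\<in>induced_copies F G. ?E X)"
  proof
    fix f assume f: "f \<in> ?S"
    then have "\<not> induced_free \<F> (induced G (f ` I))" by simp
    then obtain X F where "X \<subseteq> vertices (induced G (f ` I))" and
      XF: "F \<in> \<F>" "isomorphic (induced (induced G (f ` I)) X) F"
      by (rule not_induced_freeE)
    then have X: "X \<subseteq> f ` I" by (simp add: induced_def)
    have "f ` I \<subseteq> vertices G"
    proof (rule image_subsetI)
      fix i assume i: "i \<in> I"
      then have "f i \<in> A i" using f by (auto simp: PiE_iff)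
      then show "f i \<in> vertices G" using I(2)[OF i] by auto
    qed
    moreover have iso: "isomorphic (induced G X) F" using XF(2) by (simp add: induced_induced[OF X])
    ultimately have "X \<in> induced_copies F G"
      using X isomorphic_card[OF iso] by (simp add: induced_copies_def)
    then show "f \<in> (\<Union>F\<in>\<F>. \<Union>X\<in>induced_copies F G. ?E X)"
      using f X XF(1) by (intro UN_I[of F] UN_I[of X]) simp_all
  qed
  then have "card ?S \<le> card (\<Union>F\<in>\<F>. \<Union>X\<in>induced_copies F G. ?E X)"
    by (rule card_mono[rotated]) (rule finite_subset[OF _ fin\<Omega>], auto)
  also have "\<dots> \<le> (\<Sum>F\<in>\<F>. card (\<Union>X\<in>induced_copies F G. ?E X))"
    by (rule card_UN_le[OF \<F>])
  also have "\<dots> \<le> (\<Sum>F\<in>\<F>. \<Sum>X\<in>induced_copies F G. card (?E X))"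
    by (rule sum_mono) (rule card_UN_le[OF fincop])
  finally have "4 * real (card ?S) \<le> 4 * real (\<Sum>F\<in>\<F>. \<Sum>X\<in>induced_copies F G. card (?E X))"
    by (intro mult_left_mono of_nat_mono) simp_all
  also have "\<dots> = (\<Sum>F\<in>\<F>. 4 * (\<Sum>X\<in>induced_copies F G. real (card (?E X))))"
    by (simp add: sum_distrib_left)
  also have "\<dots> \<le> (\<Sum>F\<in>\<F>. ?\<Omega> / real (card \<F>))"
  proof (rule sum_mono)
    fix F assume F: "F \<in> \<F>"
    let ?k = "card (vertices F)" and ?m = "real (2 * card I)"
    have "card \<F> > 0" using F \<F> by (auto simp: card_gt_0_iff)
    have "real (card (?E X)) \<le> ?m ^ ?k * ?\<Omega> / ?n ^ ?k" if X: "X \<in> induced_copies F G" for X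
    proof -
      have "finite X" "card X = ?k"
        using X G(1) by (auto simp: induced_copies_def intro: finite_subset)
      then have "card (vertices G) ^ ?k * card (?E X) \<le> (2 * card I) ^ ?k * card (PiE I A)"
        using card_PiE_image_superset[OF I(1) finA I(3), where X = X] by simp
      then have "real (card (vertices G) ^ ?k * card (?E X)) \<le> real ((2 * card I) ^ ?k * card (PiE I A))"
        by (rule of_nat_mono)
      then have "?n ^ ?k * real (card (?E X)) \<le> ?m ^ ?k * ?\<Omega>"
        unfolding of_nat_mult of_nat_power .
      then show ?thesis using n by (simp add: pos_le_divide_eq mult.commute)
    qed
    then have "(\<Sum>X\<in>induced_copies F G. real (card (?E X)))
        \<le> real (card (induced_copies F G)) * (?m ^ ?k * ?\<Omega> / ?n ^ ?k)"
      by (rule sum_bounded_above)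
    also have "\<dots> \<le> \<delta> * ?n ^ ?k * (?m ^ ?k * ?\<Omega> / ?n ^ ?k)"
      using few[OF F] by (rule mult_right_mono) simp
    also have "\<dots> = \<delta> * ?m ^ ?k * ?\<Omega>" using n by simp
    finally have "4 * (\<Sum>X\<in>induced_copies F G. real (card (?E X))) \<le> 4 * \<delta> * ?m ^ ?k * ?\<Omega>"
      by simp
    also have "\<dots> \<le> 1 / real (card \<F>) * ?\<Omega>"
      using \<delta>[OF F] \<open>card \<F> > 0\<close>
      by (intro mult_right_mono) (simp_all add: pos_le_divide_eq mult.commute)
    finally show "4 * (\<Sum>X\<in>induced_copies F G. real (card (?E X))) \<le> ?\<Omega> / real (card \<F>)"
      by simp
  qed
  also have "\<dots> \<le> ?\<Omega>" by simp
  finally show ?thesis .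
qed

section \<open>Vertices with many twins\<close>

text \<open>\<open>Q\<close> takes at most a quarter of \<open>\<Omega>\<close> and the events
  \<open>Bad j\<close> together at most half, so something is left over.\<close>

lemma exists_avoiding_events:
  assumes fin: "finite \<Omega>" "\<Omega> \<noteq> {}" "finite J" and J: "real (card J) \<le> q"
    and Bad: "\<And>j. j \<in> J \<Longrightarrow> 2 * q * real (card {f \<in> \<Omega>. Bad j f}) \<le> real (card \<Omega>)"
    and Q: "4 * real (card {f \<in> \<Omega>. Q f}) \<le> real (card \<Omega>)"
  shows "\<exists>f\<in>\<Omega>. \<not> Q f \<and> (\<forall>j\<in>J. \<not> Bad j f)"
proof (rule ccontr)
  assume no: "\<not> ?thesis"
  have pos: "0 < real (card \<Omega>)" using fin by (simp add: card_gt_0_iff)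
  have "\<Omega> \<subseteq> {f \<in> \<Omega>. Q f} \<union> (\<Union>j\<in>J. {f \<in> \<Omega>. Bad j f})"
  proof
    fix f assume f: "f \<in> \<Omega>"
    then have "Q f \<or> (\<exists>j\<in>J. Bad j f)" using no by metis
    with f show "f \<in> {f \<in> \<Omega>. Q f} \<union> (\<Union>j\<in>J. {f \<in> \<Omega>. Bad j f})" by auto
  qed
  then have "card \<Omega> \<le> card ({f \<in> \<Omega>. Q f} \<union> (\<Union>j\<in>J. {f \<in> \<Omega>. Bad j f}))"
    by (rule card_mono[rotated]) (use fin in auto)
  also have "\<dots> \<le> card {f \<in> \<Omega>. Q f} + card (\<Union>j\<in>J. {f \<in> \<Omega>. Bad j f})" by (rule card_Un_le)
  also have "\<dots> \<le> card {f \<in> \<Omega>. Q f} + (\<Sum>j\<in>J. card {f \<in> \<Omega>. Bad j f})"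
    by (rule add_left_mono) (rule card_UN_le[OF fin(3)])
  finally have "real (card \<Omega>) \<le> real (card {f \<in> \<Omega>. Q f} + (\<Sum>j\<in>J. card {f \<in> \<Omega>. Bad j f}))"
    by (rule of_nat_mono)
  then have 1: "real (card \<Omega>) \<le> real (card {f \<in> \<Omega>. Q f}) + (\<Sum>j\<in>J. real (card {f \<in> \<Omega>. Bad j f}))"
    by (simp only: of_nat_add of_nat_sum)
  have "(\<Sum>j\<in>J. real (card {f \<in> \<Omega>. Bad j f})) \<le> real (card \<Omega>) / 2"
  \<comment> \<open>Positivity of \<open>q\<close>, required for the division, comes from
    \<open>J\<close> being nonempty.\<close>
  proof (cases "J = {}")
    case False
    then have "0 < real (card J)" using fin(3) by (simp add: card_gt_0_iff)
    then have q: "0 < q" using J by linarith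
    have "real (card {f \<in> \<Omega>. Bad j f}) \<le> real (card \<Omega>) / (2 * q)" if "j \<in> J" for j
      using Bad[OF that] q by (simp add: pos_le_divide_eq mult.commute)
    then have "(\<Sum>j\<in>J. real (card {f \<in> \<Omega>. Bad j f})) \<le> real (card J) * (real (card \<Omega>) / (2 * q))"
      by (rule sum_bounded_above)
    also have "\<dots> \<le> q * (real (card \<Omega>) / (2 * q))"
      using J q by (intro mult_right_mono) auto
    also have "\<dots> = real (card \<Omega>) / 2" using q by simp
    finally show ?thesis .
  qed simp
  with 1 Q pos show False by linarith
qed

lemma simple_graph_nbrs_subset: "simple_graph G \<Longrightarrow> nbrs (edges G) v \<subseteq> vertices G"
  by (auto simp: simple_graph_def nsets_def)

text \<open>Otherwise near-twins are rare in \<open>W\<close>. Sample \<open>k\<close> candidates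
  from \<open>W\<close> and \<open>N\<close> test vertices from \<open>G\<close>. With positive
  probability the sample is free of \<open>\<F>\<close>, no two candidates are near-twins, and every
  two are separated by a test vertex. Then \<open>D * N ^ D + 1\<close> distinct traces on at most
  \<open>N\<close> points shatter a set of size at least \<open>D\<close>, contrary to
  \<open>bs\<close>.\<close>

lemma exists_many_twins:
  fixes G :: "'v ugraph" and \<F> :: "'f ugraph set" and \<delta> :: real
  assumes bs: "\<forall>(H::'v ugraph) Z. simple_graph H \<and> Z \<subseteq> vertices H \<and> D \<le> card Z \<and>
      shatters (edges H) (vertices H) Z \<longrightarrow> \<not> induced_free \<F> H"
    and G: "simple_graph G" and \<F>: "finite \<F>"
    and W: "W \<subseteq> vertices G" "card (vertices G) \<le> 2 * card W"
    and N: "1 \<le> N" "1 \<le> g" and k: "k = D * N ^ D + 1"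
    and kN: "4 * real (k ^ 2) * (1 - 1 / real g) ^ N \<le> 1"
    and m: "1 \<le> m" "8 * k ^ 2 * m \<le> card (vertices G)"
    and few: "\<And>F. F \<in> \<F> \<Longrightarrow> real (card (induced_copies F G)) \<le> \<delta> * real (card (vertices G)) ^ card (vertices F)"
    and \<delta>: "\<And>F. F \<in> \<F> \<Longrightarrow> real (card \<F>) * (4 * \<delta> * real (2 * (k + N)) ^ card (vertices F)) \<le> 1"
  shows "\<exists>v\<in>W. m \<le> card {u \<in> W. g * card (sym_diff (nbrs (edges G) v) (nbrs (edges G) u)) \<le> card (vertices G)}"
proof (rule ccontr)
  assume no: "\<not> ?thesis"
  let ?n = "card (vertices G)"
  let ?sd = "\<lambda>x y. sym_diff (nbrs (edges G) x) (nbrs (edges G) y)"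
  \<comment> \<open>\<open>R1\<close> holds the near-twins in \<open>W\<close>, and
    \<open>R2\<close> the pairs that one random test vertex separates with probability above
    \<open>1 / g\<close>. Coordinates below \<open>k\<close> are candidates, those in
    \<open>T\<close> are tests.\<close>
  define R1 where "R1 = {(x, y) \<in> W \<times> W. g * card (?sd x y) \<le> ?n}"
  define R2 where "R2 = W \<times> W - R1"
  define I where "I = {..<k + N}"
  define T where "T = {k..<k + N}"
  define A where "A i = (if i < k then W else vertices G)" for i
  have finV: "finite (vertices G)" using G by (simp add: simple_graph_def)
  have finW: "finite W" using finite_subset[OF W(1) finV] .
  have k0: "1 \<le> k" using k by simp
  have n0: "0 < ?n"
  proof -
    have "1 \<le> 8 * k ^ 2 * m" using k0 m(1) by simp
    with m(2) show ?thesis by linarith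
  qed
  have cW: "0 < card W" using n0 W(2) by linarith
  have finA: "finite (A i)" for i using finV finW by (simp add: A_def)
  have Ane: "A i \<noteq> {}" for i using cW n0 by (auto simp: A_def)
  have A_sub: "A i \<subseteq> vertices G" for i using W(1) by (simp add: A_def)
  have A_big: "?n \<le> 2 * card (A i)" for i using W(2) by (simp add: A_def)
  have finI: "finite I" by (simp add: I_def)
  define \<Omega> where "\<Omega> = PiE I A"
  have fin\<Omega>: "finite \<Omega>" unfolding \<Omega>_def by (rule finite_PiE[OF finI finA])
  have \<Omega>ne: "\<Omega> \<noteq> {}" unfolding \<Omega>_def using Ane by (simp add: PiE_eq_empty_iff)
  have \<Omega>pos: "0 < real (card \<Omega>)" using fin\<Omega> \<Omega>ne by (simp add: card_gt_0_iff)
  define J where "J = {(a, b) \<in> {..<k} \<times> {..<k}. a \<noteq> b}"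
  define B1 where "B1 p f \<longleftrightarrow> (f (fst p), f (snd p)) \<in> R1" for p :: "nat \<times> nat" and f :: "nat \<Rightarrow> 'v"
  define B2 where "B2 p f \<longleftrightarrow> (f (fst p), f (snd p)) \<in> R2 \<and> (\<forall>i\<in>T. f i \<in> - ?sd (f (fst p)) (f (snd p)))"
    for p :: "nat \<times> nat" and f :: "nat \<Rightarrow> 'v"
  have cR1: "card R1 \<le> card W * m"
  proof -
    have "R1 = (SIGMA x:W. {y \<in> W. g * card (?sd x y) \<le> ?n})" by (auto simp: R1_def)
    then have "card R1 = (\<Sum>x\<in>W. card {y \<in> W. g * card (?sd x y) \<le> ?n})"
      using finW by (simp only: card_SigmaI finite_Collect_conjI simp_thms Collect_mem_eq ball_triv)
    also have "\<dots> \<le> (\<Sum>x\<in>W. m)"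
    proof (rule sum_mono)
      fix x assume "x \<in> W"
      then have "\<not> m \<le> card {y \<in> W. g * card (?sd x y) \<le> ?n}" using no by (simp only: bex_simps ball_simps) auto
      then show "card {y \<in> W. g * card (?sd x y) \<le> ?n} \<le> m" by simp
    qed
    finally show ?thesis by simp
  qed
  have B1: "4 * real (k ^ 2) * real (card {f \<in> \<Omega>. B1 p f}) \<le> real (card \<Omega>)" if p: "p \<in> J" for p
  proof -
    obtain a b where ab: "p = (a, b)" "a < k" "b < k" "a \<noteq> b" using p by (auto simp: J_def)
    have AW: "A a = W" "A b = W" using ab by (simp_all add: A_def)
    \<comment> \<open>With \<open>T = {}\<close> only the pair is constrained, and
      \<open>\<rho> = 0\<close> contributes \<open>0 ^ 0 = 1\<close>.\<close>
    have "real (card {f \<in> PiE I A. (f a, f b) \<in> R1 \<and> (\<forall>i\<in>{}. f i \<in> UNIV)}) * (real (card (A a)) * real (card (A b)))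
        \<le> real (card R1) * 0 ^ card ({} :: nat set) * real (card (PiE I A))"
      by (rule card_PiE_pair_event[where D = "\<lambda>_ _. UNIV"])
        (use finI ab finA in \<open>auto simp: I_def AW R1_def\<close>)
    then have "real (card {f \<in> \<Omega>. B1 p f}) * (real (card W) * real (card W)) \<le> real (card R1) * real (card \<Omega>)"
      by (simp add: AW B1_def ab(1) \<Omega>_def)
    also have "\<dots> \<le> real (card W * m) * real (card \<Omega>)"
      using cR1 by (intro mult_right_mono of_nat_mono) simp_all
    finally have "real (card W) * (real (card {f \<in> \<Omega>. B1 p f}) * real (card W)) \<le> real (card W) * (real m * real (card \<Omega>))"
      by (simp add: ac_simps)
    then have 1: "real (card {f \<in> \<Omega>. B1 p f}) * real (card W) \<le> real m * real (card \<Omega>)"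
      using cW by (simp only: mult_le_cancel_left_pos of_nat_0_less_iff)
    \<comment> \<open>The probability of \<open>B1 p\<close> is at most \<open>m / card W\<close>,
      and \<open>8 * k ^ 2 * m \<le> 2 * card W\<close> brings this below
      \<open>1 / (4 * k ^ 2)\<close>. The events \<open>B2 p\<close> obey the same bound, so over at
      most \<open>k ^ 2\<close> ordered pairs the total stays below one half.\<close>
    have "real (8 * k ^ 2 * m) \<le> real (2 * card W)" using m(2) W(2) by (intro of_nat_mono) linarith
    then have 2: "4 * real (k ^ 2) * real m \<le> real (card W)" by (simp add: ac_simps)
    have "4 * real (k ^ 2) * (real (card {f \<in> \<Omega>. B1 p f}) * real (card W)) \<le> 4 * real (k ^ 2) * (real m * real (card \<Omega>))"
      using 1 by (intro mult_left_mono) simp_all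
    also have "\<dots> = (4 * real (k ^ 2) * real m) * real (card \<Omega>)" by (simp only: ac_simps)
    also have "\<dots> \<le> real (card W) * real (card \<Omega>)" using 2 by (intro mult_right_mono) simp_all
    finally have "real (card W) * (4 * real (k ^ 2) * real (card {f \<in> \<Omega>. B1 p f})) \<le> real (card W) * real (card \<Omega>)"
      by (simp only: ac_simps)
    then show ?thesis using cW by (simp only: mult_le_cancel_left_pos of_nat_0_less_iff)
  qed
  \<comment> \<open>Tests are drawn from all of \<open>vertices G\<close>, where a pair in
    \<open>R2\<close> differs on more than a \<open>1 / g\<close> fraction. All \<open>N\<close>
    tests miss it with probability at most \<open>(1 - 1 / g) ^ N\<close>, which \<open>kN\<close>
    controls.\<close>
  have B2: "4 * real (k ^ 2) * real (card {f \<in> \<Omega>. B2 p f}) \<le> real (card \<Omega>)" if p: "p \<in> J" for p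
  proof -
    obtain a b where ab: "p = (a, b)" "a < k" "b < k" "a \<noteq> b" using p by (auto simp: J_def)
    have AW: "A a = W" "A b = W" using ab by (simp_all add: A_def)
    let ?\<rho> = "1 - 1 / real g"
    have \<rho>: "0 \<le> ?\<rho>" using N(2) by simp
    have "real (card {f \<in> PiE I A. (f a, f b) \<in> R2 \<and> (\<forall>i\<in>T. f i \<in> - ?sd (f a) (f b))}) * (real (card (A a)) * real (card (A b)))
        \<le> real (card R2) * ?\<rho> ^ card T * real (card (PiE I A))"
    proof (rule card_PiE_pair_event)
      show "finite I" "a \<in> I" "b \<in> I" "a \<noteq> b" "T \<subseteq> I - {a, b}" "R2 \<subseteq> A a \<times> A b"
        using finI ab by (auto simp: I_def T_def AW R2_def)
      show "finite (A i)" for i by (rule finA)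
      show "0 \<le> ?\<rho>" by (rule \<rho>)
      fix x y i assume xy: "(x, y) \<in> R2" and i: "i \<in> T"
      have "x \<in> W" "y \<in> W" "(x, y) \<notin> R1" using xy by (simp_all add: R2_def)
      then have "\<not> g * card (?sd x y) \<le> ?n" by (simp only: R1_def mem_Collect_eq case_prod_conv mem_Sigma_iff simp_thms)
      then have "?n < g * card (?sd x y)" by (rule not_le_imp_less)
      then have "real ?n < real (g * card (?sd x y))" by (simp only: of_nat_less_iff)
      then have "real ?n < real g * real (card (?sd x y))" by (simp only: of_nat_mult)
      then have 1: "real ?n / real g \<le> real (card (?sd x y))"
        using N(2) by (simp add: pos_divide_le_eq mult.commute)
      have sub: "?sd x y \<subseteq> vertices G"
        using simple_graph_nbrs_subset[OF G, of x] simple_graph_nbrs_subset[OF G, of y] by (intro Un_least) auto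
      have "A i = vertices G" using i by (simp add: A_def T_def)
      then have "card (A i \<inter> - ?sd x y) = ?n - card (?sd x y)"
        using card_Diff_subset[OF finite_subset[OF sub finV] sub] by (simp only: Diff_eq)
      moreover have "card (?sd x y) \<le> ?n" using card_mono[OF finV sub] .
      ultimately have "real (card (A i \<inter> - ?sd x y)) = real ?n - real (card (?sd x y))" by (simp only: of_nat_diff)
      also have "\<dots> \<le> ?\<rho> * real ?n" using 1 by (simp add: left_diff_distrib)
      finally show "real (card (A i \<inter> - ?sd x y)) \<le> ?\<rho> * real (card (A i))"
        using \<open>A i = vertices G\<close> by simp
    qed
    then have "real (card {f \<in> \<Omega>. B2 p f}) * (real (card W) * real (card W)) \<le> real (card R2) * ?\<rho> ^ N * real (card \<Omega>)"
      by (simp only: AW B2_def ab(1) \<Omega>_def fst_conv snd_conv) (simp add: T_def)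
    also have "\<dots> \<le> real (card W * card W) * ?\<rho> ^ N * real (card \<Omega>)"
    proof -
      have "card R2 \<le> card (W \<times> W)" by (rule card_mono) (use finW in \<open>auto simp: R2_def\<close>)
      then have "card R2 \<le> card W * card W" by (simp only: card_cartesian_product)
      then show ?thesis using \<rho> by (intro mult_right_mono of_nat_mono) simp_all
    qed
    finally have "(real (card W) * real (card W)) * real (card {f \<in> \<Omega>. B2 p f})
        \<le> (real (card W) * real (card W)) * (?\<rho> ^ N * real (card \<Omega>))"
      by (simp only: ac_simps of_nat_mult)
    moreover have "0 < real (card W) * real (card W)" using cW by simp
    ultimately have "real (card {f \<in> \<Omega>. B2 p f}) \<le> ?\<rho> ^ N * real (card \<Omega>)"
      by (simp only: mult_le_cancel_left_pos)
    then have "4 * real (k ^ 2) * real (card {f \<in> \<Omega>. B2 p f}) \<le> 4 * real (k ^ 2) * (?\<rho> ^ N * real (card \<Omega>))"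
      by (intro mult_left_mono) simp_all
    also have "\<dots> = (4 * real (k ^ 2) * ?\<rho> ^ N) * real (card \<Omega>)" by (simp only: ac_simps)
    also have "\<dots> \<le> 1 * real (card \<Omega>)" using kN by (intro mult_right_mono) simp_all
    finally show ?thesis by simp
  qed
  have J: "finite J" "real (card J) \<le> real (k ^ 2)"
  proof -
    have sub: "J \<subseteq> {..<k} \<times> {..<k}" by (auto simp: J_def)
    show "finite J" by (rule finite_subset[OF sub]) simp
    have "card J \<le> card ({..<k} \<times> {..<k})" by (rule card_mono[OF _ sub]) simp
    then show "real (card J) \<le> real (k ^ 2)" by (intro of_nat_mono) (simp add: power2_eq_square)
  qed
  have bad: "2 * real (k ^ 2) * real (card {f \<in> \<Omega>. B1 p f \<or> B2 p f}) \<le> real (card \<Omega>)" if p: "p \<in> J" for p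
  proof -
    have "{f \<in> \<Omega>. B1 p f \<or> B2 p f} = {f \<in> \<Omega>. B1 p f} \<union> {f \<in> \<Omega>. B2 p f}" by auto
    then have "real (card {f \<in> \<Omega>. B1 p f \<or> B2 p f}) \<le> real (card {f \<in> \<Omega>. B1 p f} + card {f \<in> \<Omega>. B2 p f})"
      by (intro of_nat_mono) (simp only: card_Un_le)
    then have "2 * real (k ^ 2) * real (card {f \<in> \<Omega>. B1 p f \<or> B2 p f})
        \<le> 2 * real (k ^ 2) * real (card {f \<in> \<Omega>. B1 p f} + card {f \<in> \<Omega>. B2 p f})"
      by (intro mult_left_mono) simp_all
    also have "\<dots> = 2 * real (k ^ 2) * real (card {f \<in> \<Omega>. B1 p f}) + 2 * real (k ^ 2) * real (card {f \<in> \<Omega>. B2 p f})"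
      by (simp only: of_nat_add distrib_left)
    finally show ?thesis using B1[OF p] B2[OF p] by linarith
  qed
  have free: "4 * real (card {f \<in> \<Omega>. \<not> induced_free \<F> (induced G (f ` I))}) \<le> real (card \<Omega>)"
    unfolding \<Omega>_def
  proof (rule card_PiE_not_induced_free[OF finV _ \<F> finI A_sub A_big few])
    show "vertices G \<noteq> {}" using n0 by auto
    show "real (card \<F>) * (4 * \<delta> * real (2 * card I) ^ card (vertices F)) \<le> 1" if "F \<in> \<F>" for F
      using \<delta>[OF that] by (simp only: I_def card_lessThan)
  qed
  have "\<exists>f\<in>\<Omega>. \<not> \<not> induced_free \<F> (induced G (f ` I)) \<and> (\<forall>p\<in>J. \<not> (B1 p f \<or> B2 p f))"
    by (rule exists_avoiding_events[OF fin\<Omega> \<Omega>ne J _ free]) (rule bad)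
  then obtain f where f: "f \<in> \<Omega>" "\<not> \<not> induced_free \<F> (induced G (f ` I))"
      and good: "\<forall>p\<in>J. \<not> (B1 p f \<or> B2 p f)"
    by (elim bexE conjE)
  define H where "H = induced G (f ` I)"
  have vH: "vertices H = f ` I" and eH: "edges H = {e \<in> edges G. e \<subseteq> f ` I}" by (simp_all add: H_def induced_def)
  have fA: "f i \<in> A i" if "i \<in> I" for i using f(1) that by (auto simp: \<Omega>_def PiE_iff)
  have fIV: "f ` I \<subseteq> vertices G" using fA A_sub by (intro image_subsetI) (rule subsetD)
  have H: "simple_graph H" unfolding H_def by (rule simple_graph_induced[OF G fIV])
  define tr where "tr a = nbrs (edges G) (f a) \<inter> f ` T" for a
  \<comment> \<open>Coinciding candidates need no extra care: a vertex is a twin of itself, so such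
    a pair lies in \<open>R1\<close>.\<close>
  have "inj_on tr {..<k}"
  proof (rule inj_onI, rule ccontr)
    fix a b assume ab: "a \<in> {..<k}" "b \<in> {..<k}" "tr a = tr b" "a \<noteq> b"
    then have "(a, b) \<in> J" by (simp add: J_def)
    from good[rule_format, OF this] have nb: "\<not> B1 (a, b) f" "\<not> B2 (a, b) f" by simp_all
    have "f a \<in> W" "f b \<in> W" using fA[of a] fA[of b] ab by (simp_all add: A_def I_def)
    with nb(1) have "(f a, f b) \<in> R2" by (simp add: B1_def R2_def)
    with nb(2) have "\<exists>i\<in>T. f i \<in> ?sd (f a) (f b)"
      by (simp only: B2_def fst_conv snd_conv simp_thms Compl_iff ball_simps not_not)
    then obtain i where i: "i \<in> T" "f i \<in> ?sd (f a) (f b)" by (rule bexE)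
    then have "f i \<in> tr a \<longleftrightarrow> f i \<notin> tr b" by (auto simp: tr_def)
    with ab(3) show False by simp
  qed
  then have "card (tr ` {..<k}) = k" by (simp add: card_image)
  then have big: "D * N ^ D < card (tr ` {..<k})" using k by simp
  have fT: "finite (f ` T)" "card (f ` T) \<le> N"
    using card_image_le[of T f] by (simp_all add: T_def)
  obtain Z where Z: "Z \<subseteq> f ` T" "D \<le> card Z" "shattered (tr ` {..<k}) Z"
    by (rule sauer_shelah[OF fT N(1) _ big]) (auto simp: tr_def)
  have ZH: "Z \<subseteq> f ` I" using Z(1) by (rule order_trans) (auto simp: T_def I_def)
  have "shatters (edges H) (vertices H) Z"
    unfolding shatters_def
  proof (intro allI impI)
    fix Y assume "Y \<subseteq> Z"
    with Z(3) obtain S where S: "S \<in> tr ` {..<k}" "S \<inter> Z = Y" by (rule shatteredE)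
    then obtain a where a: "a < k" "S = tr a" by auto
    have fa: "f a \<in> vertices H" using a by (simp add: vH I_def)
    have "nbrs (edges H) (f a) \<inter> Z = tr a \<inter> Z"
    proof (intro set_eqI iffI)
      fix u assume "u \<in> tr a \<inter> Z"
      then show "u \<in> nbrs (edges H) (f a) \<inter> Z" using ZH fa by (auto simp: tr_def eH vH)
    next
      fix u assume "u \<in> nbrs (edges H) (f a) \<inter> Z"
      then show "u \<in> tr a \<inter> Z" using Z(1) by (auto simp: tr_def eH)
    qed
    then show "\<exists>w\<in>vertices H. nbrs (edges H) w \<inter> Z = Y" using fa S(2) a(2) by (intro bexI[of _ "f a"]) simp_all
  qed
  then have "\<not> induced_free \<F> H"
    by (intro bs[rule_format, of H Z] conjI H Z(2)) (simp only: vH ZH)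
  with f(2) show False by (simp add: H_def)
qed

section \<open>Disjoint clusters and homogeneous unions\<close>

text \<open>Take an admissible family with as many members as possible. If it covered less than half
  of \<open>V\<close>, then \<open>step\<close> would apply to the uncovered part and supply one
  more member, new because \<open>1 \<le> m\<close> makes it nonempty.\<close>

lemma maximal_disjoint_family:
  assumes V: "finite V" and m: "1 \<le> m"
    and step: "\<And>W. W \<subseteq> V \<Longrightarrow> card V \<le> 2 * card W \<Longrightarrow> \<exists>C\<subseteq>W. card C = m \<and> ok C"
  obtains \<P> where "finite \<P>" "pairwise disjnt \<P>" "\<Union>\<P> \<subseteq> V" "card V \<le> 2 * card (\<Union>\<P>)"
    "\<And>C. C \<in> \<P> \<Longrightarrow> card C = m" "\<And>C. C \<in> \<P> \<Longrightarrow> ok C"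
proof -
  define good where "good \<P> \<longleftrightarrow> \<P> \<subseteq> Pow V \<and> pairwise disjnt \<P> \<and> (\<forall>C\<in>\<P>. card C = m \<and> ok C)" for \<P>
  have "good {}" by (simp add: good_def)
  moreover have "\<forall>\<P>. good \<P> \<longrightarrow> card \<P> < Suc (card (Pow V))"
    using V by (simp add: good_def card_mono less_Suc_eq_le del: card_Pow)
  ultimately have "\<exists>\<P>. good \<P> \<and> (\<forall>\<Q>. good \<Q> \<longrightarrow> card \<Q> \<le> card \<P>)"
    by (rule ex_has_greatest_nat)
  then obtain \<P> where \<P>: "good \<P>" and max: "\<forall>\<Q>. good \<Q> \<longrightarrow> card \<Q> \<le> card \<P>"
    by (elim exE conjE)
  have sub: "\<Union>\<P> \<subseteq> V" using \<P> by (auto simp: good_def)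
  have finP: "finite \<P>" by (rule finite_subset[of _ "Pow V"]) (use \<P> V in \<open>auto simp: good_def\<close>)
  have "card V \<le> 2 * card (\<Union>\<P>)"
  proof (rule ccontr)
    assume small: "\<not> ?thesis"
    have "card (V - \<Union>\<P>) = card V - card (\<Union>\<P>)"
      by (rule card_Diff_subset[OF finite_subset[OF sub V] sub])
    then have "card V \<le> 2 * card (V - \<Union>\<P>)" using small by linarith
    from step[OF Diff_subset this] obtain C where C: "C \<subseteq> V - \<Union>\<P>" "card C = m" "ok C"
      by (elim exE conjE)
    have "C \<noteq> {}" using C(2) m by auto
    then have "C \<notin> \<P>" using C(1) by auto
    have dis: "disjnt C P" if "P \<in> \<P>" for P using C(1) that by (auto simp: disjnt_def)
    have "good (insert C \<P>)"
      unfolding good_def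
    proof (intro conjI)
      show "insert C \<P> \<subseteq> Pow V" using \<P> C(1) by (auto simp: good_def)
      show "pairwise disjnt (insert C \<P>)"
        using \<P> dis by (simp add: good_def pairwise_insert disjnt_sym)
      show "\<forall>D\<in>insert C \<P>. card D = m \<and> ok D" using \<P> C by (simp add: good_def)
    qed
    with max have "card (insert C \<P>) \<le> card \<P>" by simp
    then show False using \<open>C \<notin> \<P>\<close> finP by simp
  qed
  then show thesis using that[OF finP _ sub] \<P> by (simp add: good_def)
qed

section \<open>Edge density in terms of ordered pairs\<close>

abbreviation cross_edges :: "'v set set \<Rightarrow> 'v set \<Rightarrow> 'v set \<Rightarrow> ('v \<times> 'v) set" where
  "cross_edges E P Q \<equiv> {(x, y) \<in> P \<times> Q. {x, y} \<in> E}"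

abbreviation cross_nonedges :: "'v set set \<Rightarrow> 'v set \<Rightarrow> 'v set \<Rightarrow> ('v \<times> 'v) set" where
  "cross_nonedges E P Q \<equiv> {(x, y) \<in> P \<times> Q. {x, y} \<notin> E}"

lemma two_card_edges:
  assumes "simple_graph G" "X \<subseteq> vertices G"
  shows "2 * card (edges (induced G X)) = card (cross_edges (edges G) X X)"
proof -
  let ?S = "{e \<in> edges G. e \<subseteq> X}"
  let ?O = "\<lambda>e. {(x, y). {x, y} = e}"
  have fX: "finite X" using assms finite_subset by (auto simp: simple_graph_def)
  have fS: "finite ?S" by (rule finite_subset[of _ "Pow X"]) (use fX in auto)
  have two: "\<exists>a b. a \<noteq> b \<and> e = {a, b}" if "e \<in> ?S" for e
  proof -
    have "card e = 2" using that assms(1) by (auto simp: simple_graph_def nsets_def)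
    then show ?thesis by (auto simp: card_2_iff)
  qed
  have O: "finite (?O e) \<and> card (?O e) = 2" if e: "e \<in> ?S" for e
  proof -
    obtain a b where ab: "a \<noteq> b" "e = {a, b}" using two[OF e] by (elim exE conjE)
    have "?O e = {(a, b), (b, a)}" unfolding ab(2) by (auto simp: doubleton_eq_iff)
    then show ?thesis using ab(1) by simp
  qed
  have "cross_edges (edges G) X X = (\<Union>e\<in>?S. ?O e)" by auto
  then have "card (cross_edges (edges G) X X) = card (\<Union>e\<in>?S. ?O e)" by (rule arg_cong)
  also have "\<dots> = (\<Sum>e\<in>?S. card (?O e))"
    by (rule card_UN_disjoint[OF fS]) (use O in auto)
  also have "\<dots> = (\<Sum>e\<in>?S. 2)" by (rule sum.cong[OF refl]) (use O in simp)
  finally show ?thesis by (simp add: induced_def)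
qed

lemma card_cross_edges_nonedges:
  assumes "finite P" "finite Q"
  shows "card (cross_edges E P Q) + card (cross_nonedges E P Q) = card P * card Q"
proof -
  have fin: "finite (P \<times> Q)" using assms by simp
  have "card (cross_edges E P Q) + card (cross_nonedges E P Q) = card (cross_edges E P Q \<union> cross_nonedges E P Q)"
    by (rule card_Un_disjoint[symmetric]) (rule finite_subset[OF _ fin], auto)+
  also have "cross_edges E P Q \<union> cross_nonedges E P Q = P \<times> Q" by auto
  finally show ?thesis by (simp add: card_cartesian_product)
qed

lemma edge_density_eq:
  assumes "simple_graph G" "X \<subseteq> vertices G"
  shows "edge_density G X = real (card (cross_edges (edges G) X X)) / real (card X * (card X - 1))"
proof -
  have "even (card X * (card X - 1))" by (cases "card X") auto
  then have "card X * (card X - 1) = 2 * (card X choose 2)" unfolding choose_two by simp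
  then have "real (card X * (card X - 1)) = real (2 * (card X choose 2))" by (rule arg_cong)
  then have "real (card X * (card X - 1)) = 2 * real (card X choose 2)" by simp
  moreover have "real (card (cross_edges (edges G) X X)) = 2 * real (card (edges (induced G X)))"
    unfolding two_card_edges[OF assms, symmetric] by simp
  ultimately show ?thesis by (simp add: edge_density_def)
qed

text \<open>The relation \<open>r\<close> is abstract so that it can stand for adjacency or for
  non-adjacency. Pairs across clusters contribute about a \<open>1 / (2 * e)\<close> fraction at
  most; pairs inside clusters may all be in \<open>r\<close>, but since there are at least
  \<open>2 * e\<close> clusters they add no more than another such fraction.\<close>

lemma card_sparse_union:
  fixes r :: "'v \<Rightarrow> 'v \<Rightarrow> bool"
  assumes Q: "finite \<Q>" "pairwise disjnt \<Q>" "\<And>P. P \<in> \<Q> \<Longrightarrow> card P = m" "1 \<le> m"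
    and e: "1 \<le> e" "2 * e \<le> card \<Q>"
    and sparse: "\<And>P Q. P \<in> \<Q> \<Longrightarrow> Q \<in> \<Q> \<Longrightarrow> P \<noteq> Q \<Longrightarrow> 2 * e * card {(x, y) \<in> P \<times> Q. r x y} \<le> m * m"
    and irrefl: "\<And>x. \<not> r x x"
  shows "card (\<Union>\<Q>) = card \<Q> * m"
    and "e * card {(x, y) \<in> \<Union>\<Q> \<times> \<Union>\<Q>. r x y} \<le> card (\<Union>\<Q>) * (card (\<Union>\<Q>) - 1)"
proof -
  let ?q = "card \<Q>"
  have fin: "finite P" if "P \<in> \<Q>" for P using Q(3)[OF that] Q(4) by (simp add: card_ge_0_finite)
  have "card (\<Union>\<Q>) = sum card \<Q>" by (rule card_Union_disjoint[OF Q(2) fin])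
  then show cU: "card (\<Union>\<Q>) = ?q * m" using Q(3) by simp
  let ?E = "\<lambda>P Q. {(x, y) \<in> P \<times> Q. r x y}"
  have finE: "finite (?E P Q)" if "P \<in> \<Q>" "Q \<in> \<Q>" for P Q
    by (rule finite_subset[of _ "P \<times> Q"]) (use fin that in auto)
  \<comment> \<open>Dropping the diagonal matters for \<open>m = 1\<close>: with
    \<open>m * m\<close> in place of \<open>m * (m - 1)\<close> the final estimate would fail
    there.\<close>
  have diag: "card (?E P P) \<le> m * (m - 1)" if P: "P \<in> \<Q>" for P
  proof -
    have "?E P P \<subseteq> P \<times> P - (\<lambda>x. (x, x)) ` P" using irrefl by auto
    then have "card (?E P P) \<le> card (P \<times> P - (\<lambda>x. (x, x)) ` P)"
      by (rule card_mono[rotated]) (use fin[OF P] in simp)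
    also have "\<dots> = card (P \<times> P) - card ((\<lambda>x. (x, x)) ` P)"
      by (rule card_Diff_subset) (use fin[OF P] in auto)
    also have "card ((\<lambda>x. (x, x)) ` P) = card P" by (rule card_image) (simp add: inj_on_def)
    finally show ?thesis using Q(3)[OF P] by (simp add: card_cartesian_product diff_mult_distrib2)
  qed
  have row: "2 * e * (\<Sum>Q\<in>\<Q>. card (?E P Q)) \<le> 2 * e * (m * (m - 1)) + (?q - 1) * (m * m)" if P: "P \<in> \<Q>" for P
  proof -
    have "2 * e * (\<Sum>Q\<in>\<Q>. card (?E P Q)) = 2 * e * card (?E P P) + (\<Sum>Q\<in>\<Q> - {P}. 2 * e * card (?E P Q))"
      by (simp add: sum.remove[OF Q(1) P] sum_distrib_left distrib_left)
    also have "\<dots> \<le> 2 * e * (m * (m - 1)) + (\<Sum>Q\<in>\<Q> - {P}. m * m)"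
    proof (rule add_mono)
      show "2 * e * card (?E P P) \<le> 2 * e * (m * (m - 1))" using diag[OF P] by (rule mult_le_mono2)
      show "(\<Sum>Q\<in>\<Q> - {P}. 2 * e * card (?E P Q)) \<le> (\<Sum>Q\<in>\<Q> - {P}. m * m)"
      proof (rule sum_mono)
        fix Q assume "Q \<in> \<Q> - {P}"
        then have "Q \<in> \<Q>" "P \<noteq> Q" by auto
        then show "2 * e * card (?E P Q) \<le> m * m" by (rule sparse[OF P])
      qed
    qed
    also have "(\<Sum>Q\<in>\<Q> - {P}. m * m) = (?q - 1) * (m * m)" using Q(1) P by simp
    finally show ?thesis .
  qed
  have "?E (\<Union>\<Q>) (\<Union>\<Q>) \<subseteq> (\<Union>P\<in>\<Q>. \<Union>Q\<in>\<Q>. ?E P Q)" by auto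
  then have "card (?E (\<Union>\<Q>) (\<Union>\<Q>)) \<le> card (\<Union>P\<in>\<Q>. \<Union>Q\<in>\<Q>. ?E P Q)"
    by (rule card_mono[rotated]) (use Q(1) finE in auto)
  also have "\<dots> \<le> (\<Sum>P\<in>\<Q>. card (\<Union>Q\<in>\<Q>. ?E P Q))" by (rule card_UN_le[OF Q(1)])
  also have "\<dots> \<le> (\<Sum>P\<in>\<Q>. \<Sum>Q\<in>\<Q>. card (?E P Q))" by (rule sum_mono) (rule card_UN_le[OF Q(1)])
  finally have "2 * e * card (?E (\<Union>\<Q>) (\<Union>\<Q>)) \<le> 2 * e * (\<Sum>P\<in>\<Q>. \<Sum>Q\<in>\<Q>. card (?E P Q))"
    by (rule mult_le_mono2)
  also have "\<dots> = (\<Sum>P\<in>\<Q>. 2 * e * (\<Sum>Q\<in>\<Q>. card (?E P Q)))" by (rule sum_distrib_left)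
  also have "\<dots> \<le> (\<Sum>P\<in>\<Q>. 2 * e * (m * (m - 1)) + (?q - 1) * (m * m))" by (rule sum_mono) (rule row)
  also have "\<dots> = ?q * (2 * e * (m * (m - 1)) + (?q - 1) * (m * m))" by simp
  also have "\<dots> \<le> 2 * (?q * m * (?q * m - 1))"
  proof -
    obtain m' where m': "m = Suc m'" using Q(4) by (cases m) auto
    obtain q' where q': "?q = Suc q'" using e by (cases ?q) auto
    have "2 * e * (m * (m - 1)) \<le> ?q * (m * (m - 1))" using e(2) by (rule mult_le_mono1)
    then have "2 * e * (m * (m - 1)) + (?q - 1) * (m * m) \<le> ?q * (m * (m - 1)) + (?q - 1) * (m * m)" by simp
    also have "\<dots> \<le> 2 * (m * (?q * m - 1))" unfolding m' q' by (simp add: algebra_simps)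
    finally have "?q * (2 * e * (m * (m - 1)) + (?q - 1) * (m * m)) \<le> ?q * (2 * (m * (?q * m - 1)))"
      by (rule mult_le_mono2)
    then show ?thesis by (simp add: ac_simps)
  qed
  finally show "e * card (?E (\<Union>\<Q>) (\<Union>\<Q>)) \<le> card (\<Union>\<Q>) * (card (\<Union>\<Q>) - 1)"
    unfolding cU by simp
qed

text \<open>
  A pair of points of \<open>\<Union>\<P>\<close> outside this set lies in two different clusters and has the adjacency of all but a
  \<open>1 / (2 * e)\<close> fraction of the pairs between them.
\<close>

definition bad_pairs :: "'v set set \<Rightarrow> nat \<Rightarrow> 'v set set \<Rightarrow> ('v \<times> 'v) set" where
  "bad_pairs E e \<P> = {(x, y). \<exists>P\<in>\<P>. \<exists>Q\<in>\<P>. x \<in> P \<and> y \<in> Q \<and>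
     (P = Q \<or> {x, y} \<in> E \<and> card P * card Q < 2 * e * card (cross_nonedges E P Q) \<or>
      {x, y} \<notin> E \<and> card P * card Q < 2 * e * card (cross_edges E P Q))}"

lemma mem_bad_pairsI:
  assumes "P \<in> \<P>" "Q \<in> \<P>" "x \<in> P" "y \<in> Q"
    "P = Q \<or> {x, y} \<in> E \<and> card P * card Q < 2 * e * card (cross_nonedges E P Q) \<or>
      {x, y} \<notin> E \<and> card P * card Q < 2 * e * card (cross_edges E P Q)"
  shows "(x, y) \<in> bad_pairs E e \<P>"
  unfolding bad_pairs_def mem_Collect_eq case_prod_conv
  by (intro bexI[OF _ assms(1)] bexI[OF _ assms(2)] conjI assms(3-5))

text \<open>Points of one cluster form bad pairs, so \<open>S\<close> meets every cluster at most
  once and meets at least \<open>2 * e\<close> of them; these form \<open>\<Q>\<close>. Any two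
  members of \<open>\<Q>\<close> are represented by a pair from \<open>S\<close> that is not bad.
  Its adjacency, the same throughout \<open>S\<close>, is thus shared by all but a
  \<open>1 / (2 * e)\<close> fraction of the pairs between the two clusters, and
  \<open>card_sparse_union\<close> applies to the minority.\<close>

lemma homogeneous_union:
  assumes G: "simple_graph G"
    and P: "finite \<P>" "pairwise disjnt \<P>" "\<Union>\<P> \<subseteq> vertices G" "\<And>P. P \<in> \<P> \<Longrightarrow> card P = m" "1 \<le> m"
    and e: "1 \<le> e" "1 / real e \<le> \<epsilon>"
    and S: "S \<subseteq> \<Union>\<P>" "finite S" "2 * e \<le> card S" "clique S (edges G) \<or> indep S (edges G)"
    and good: "\<And>x y. x \<in> S \<Longrightarrow> y \<in> S \<Longrightarrow> x \<noteq> y \<Longrightarrow> (x, y) \<notin> bad_pairs (edges G) e \<P>"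
  shows "\<exists>X. homogeneous \<epsilon> G X \<and> m \<le> card X"
proof -
  let ?E = "edges G"
  define \<Q> where "\<Q> = {P \<in> \<P>. P \<inter> S \<noteq> {}}"
  have Q: "finite \<Q>" "pairwise disjnt \<Q>" "\<And>P. P \<in> \<Q> \<Longrightarrow> card P = m"
    using P by (auto simp: \<Q>_def intro: pairwise_subset)
  have "\<forall>x\<in>S. \<exists>P. P \<in> \<P> \<and> x \<in> P" using S(1) by auto
  from bchoice[OF this] obtain cl where cl: "\<forall>x\<in>S. cl x \<in> \<P> \<and> x \<in> cl x" ..
  have "inj_on cl S"
  proof (rule inj_onI, rule ccontr)
    fix x y assume xy: "x \<in> S" "y \<in> S" "cl x = cl y" "x \<noteq> y"
    have "cl x \<in> \<P>" "x \<in> cl x" "y \<in> cl x" using cl[rule_format, OF xy(1)] cl[rule_format, OF xy(2)] xy(3) by simp_all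
    then have "(x, y) \<in> bad_pairs ?E e \<P>" using mem_bad_pairsI[of "cl x" \<P> "cl x" x y ?E e] by simp
    with good[OF xy(1,2,4)] show False by simp
  qed
  moreover have "cl ` S \<subseteq> \<Q>" using cl by (auto simp: \<Q>_def)
  ultimately have "card S \<le> card \<Q>" using Q(1) by (rule card_inj_on_le)
  then have q: "2 * e \<le> card \<Q>" using S(3) by simp
  have rep: "\<exists>x\<in>S. \<exists>y\<in>S. x \<noteq> y \<and> x \<in> P \<and> y \<in> Q \<and> (x, y) \<notin> bad_pairs ?E e \<P>"
    if PQ: "P \<in> \<Q>" "Q \<in> \<Q>" "P \<noteq> Q" for P Q
  proof -
    obtain x y where xy: "x \<in> S" "x \<in> P" "y \<in> S" "y \<in> Q" using PQ(1,2) by (auto simp: \<Q>_def)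
    have "disjnt P Q" using Q(2) PQ by (simp add: pairwise_def)
    then have "x \<noteq> y" using xy by (auto simp: disjnt_def)
    with xy good[OF xy(1,3)] show ?thesis by auto
  qed
  define X where "X = \<Union>\<Q>"
  have XV: "X \<subseteq> vertices G" using P(3) by (auto simp: X_def \<Q>_def)
  have finX: "finite X" using finite_subset[OF XV] G by (simp add: simple_graph_def)
  let ?N = "card X * (card X - 1)"
  have "card X = card \<Q> * m \<and> (e * card (cross_edges ?E X X) \<le> ?N \<or>
      e * card {(x, y) \<in> X \<times> X. x \<noteq> y \<and> {x, y} \<notin> ?E} \<le> ?N)"
    using S(4)
  proof
    assume cl: "clique S ?E"
    \<comment> \<open>The condition \<open>x \<noteq> y\<close> makes the relation irreflexive, as
      \<open>card_sparse_union\<close> demands; between disjoint clusters it always holds.\<close>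
    have sparse: "2 * e * card {(x, y) \<in> P \<times> Q. x \<noteq> y \<and> {x, y} \<notin> ?E} \<le> m * m"
      if PQ: "P \<in> \<Q>" "Q \<in> \<Q>" "P \<noteq> Q" for P Q
    proof -
      obtain x y where xy: "x \<in> S" "y \<in> S" "x \<noteq> y" "x \<in> P" "y \<in> Q" "(x, y) \<notin> bad_pairs ?E e \<P>"
        using rep[OF PQ] by (elim bexE conjE)
      have "{x, y} \<in> ?E" using cl xy by (simp add: clique_def)
      moreover have "P \<in> \<P>" "Q \<in> \<P>" using PQ by (simp_all add: \<Q>_def)
      ultimately have "\<not> card P * card Q < 2 * e * card (cross_nonedges ?E P Q)"
        using mem_bad_pairsI[OF _ _ xy(4,5), of \<P> ?E e] xy(6) by argo
      then have 1: "2 * e * card (cross_nonedges ?E P Q) \<le> m * m" using Q(3)[OF PQ(1)] Q(3)[OF PQ(2)] by simp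
      have "finite (P \<times> Q)" using Q(3)[OF PQ(1)] Q(3)[OF PQ(2)] P(5) by (simp add: card_ge_0_finite)
      then have "card {(x, y) \<in> P \<times> Q. x \<noteq> y \<and> {x, y} \<notin> ?E} \<le> card (cross_nonedges ?E P Q)"
        by (intro card_mono) (auto intro: finite_subset[of _ "P \<times> Q"])
      then have "2 * e * card {(x, y) \<in> P \<times> Q. x \<noteq> y \<and> {x, y} \<notin> ?E} \<le> 2 * e * card (cross_nonedges ?E P Q)"
        by (rule mult_le_mono2)
      with 1 show ?thesis by linarith
    qed
    note sparse_union = card_sparse_union[where r = "\<lambda>x y. x \<noteq> y \<and> {x, y} \<notin> ?E", OF Q(1,2) _ P(5) e(1) q]
    show ?thesis
      unfolding X_def
    proof (intro conjI disjI2)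
      show "card (\<Union>\<Q>) = card \<Q> * m"
        by (rule sparse_union(1), erule Q(3), erule (2) sparse, simp)
      show "e * card {(x, y) \<in> \<Union>\<Q> \<times> \<Union>\<Q>. x \<noteq> y \<and> {x, y} \<notin> ?E} \<le> card (\<Union>\<Q>) * (card (\<Union>\<Q>) - 1)"
        by (rule sparse_union(2), erule Q(3), erule (2) sparse, simp)
    qed
  next
    assume ind: "indep S ?E"
    have sparse: "2 * e * card (cross_edges ?E P Q) \<le> m * m"
      if PQ: "P \<in> \<Q>" "Q \<in> \<Q>" "P \<noteq> Q" for P Q
    proof -
      obtain x y where xy: "x \<in> S" "y \<in> S" "x \<noteq> y" "x \<in> P" "y \<in> Q" "(x, y) \<notin> bad_pairs ?E e \<P>"
        using rep[OF PQ] by (elim bexE conjE)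
      have "{x, y} \<notin> ?E" using ind xy by (simp add: indep_def)
      moreover have "P \<in> \<P>" "Q \<in> \<P>" using PQ by (simp_all add: \<Q>_def)
      ultimately have "\<not> card P * card Q < 2 * e * card (cross_edges ?E P Q)"
        using mem_bad_pairsI[OF _ _ xy(4,5), of \<P> ?E e] xy(6) by argo
      then show ?thesis using Q(3)[OF PQ(1)] Q(3)[OF PQ(2)] by simp
    qed
    have irr: "\<not> {x, x} \<in> ?E" for x by (rule simple_graph_no_loop[OF G])
    note sparse_union = card_sparse_union[where r = "\<lambda>x y. {x, y} \<in> ?E", OF Q(1,2) _ P(5) e(1) q]
    show ?thesis
      unfolding X_def
    proof (intro conjI disjI1)
      show "card (\<Union>\<Q>) = card \<Q> * m"
        by (rule sparse_union(1), erule Q(3), erule (2) sparse, rule irr)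
      show "e * card (cross_edges ?E (\<Union>\<Q>) (\<Union>\<Q>)) \<le> card (\<Union>\<Q>) * (card (\<Union>\<Q>) - 1)"
        by (rule sparse_union(2), erule Q(3), erule (2) sparse, rule irr)
    qed
  qed
  note cX = this[THEN conjunct1] and dich = this[THEN conjunct2]
  have X2: "2 \<le> card X"
  proof -
    have "2 * 1 \<le> card \<Q> * m" using q e(1) P(5) by (intro mult_le_mono) linarith+
    then show ?thesis by (simp add: cX)
  qed
  have mX: "m \<le> card X" unfolding cX using q e(1) by simp
  have N: "0 < real ?N" using X2 by simp
  have le_eps: "real c / real ?N \<le> \<epsilon>" if c: "e * c \<le> ?N" for c
  proof -
    have "real (e * c) \<le> real ?N" using c by (rule of_nat_mono)
    then have "real c \<le> real ?N * (1 / real e)" using e(1) by (simp add: field_simps)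
    also have "\<dots> \<le> real ?N * \<epsilon>" using e(2) by (rule mult_left_mono) simp
    finally show ?thesis by (simp only: pos_divide_le_eq[OF N] mult.commute)
  qed
  have "edge_density G X \<le> \<epsilon> \<or> 1 - \<epsilon> \<le> edge_density G X"
    using dich
  proof
    assume "e * card (cross_edges ?E X X) \<le> ?N"
    then show ?thesis unfolding edge_density_eq[OF G XV] by (intro disjI1 le_eps)
  next
    let ?D = "{(x, y) \<in> X \<times> X. x \<noteq> y \<and> {x, y} \<notin> ?E}"
    assume le: "e * card ?D \<le> ?N"
    have fin2: "finite (X \<times> X)" using finX by simp
    \<comment> \<open>The ordered nonedges of \<open>X\<close> include the \<open>card X\<close>
      diagonal pairs. Removing these turns \<open>card X * card X\<close> into \<open>?N\<close>, so
      edges and \<open>?D\<close> are complementary.\<close>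
    have "card ?D + card ((\<lambda>x. (x, x)) ` X) = card (?D \<union> (\<lambda>x. (x, x)) ` X)"
      by (rule card_Un_disjoint[symmetric]) (rule finite_subset[OF _ fin2], auto)+
    also have "?D \<union> (\<lambda>x. (x, x)) ` X = cross_nonedges ?E X X"
      using simple_graph_no_loop[OF G] by auto
    also have "card ((\<lambda>x. (x, x)) ` X) = card X" by (rule card_image) (simp add: inj_on_def)
    finally have "card (cross_edges ?E X X) + card ?D + card X = card X * card X"
      using card_cross_edges_nonedges[OF finX finX, of ?E] by simp
    then have "card (cross_edges ?E X X) + card ?D = ?N" by (simp add: diff_mult_distrib2)
    then have "real (card (cross_edges ?E X X) + card ?D) = real ?N" by (rule arg_cong)
    then have "real (card (cross_edges ?E X X)) = real ?N - real (card ?D)"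
      unfolding of_nat_add by (rule eq_diff_eq[THEN iffD2])
    then have "edge_density G X = 1 - real (card ?D) / real ?N"
      unfolding edge_density_eq[OF G XV]
      by (simp only: diff_divide_distrib divide_self[OF less_imp_neq[OF N, symmetric]])
    then show ?thesis using le_eps[OF le] by simp
  qed
  then have "homogeneous \<epsilon> G X" using XV X2 by (simp add: homogeneous_def)
  with mX show ?thesis by (intro exI conjI)
qed

section \<open>Counting atypical pairs\<close>

text \<open>An edge together with a nonedge between \<open>P\<close> and \<open>Q\<close> always
  contains a vertex of one side that separates two vertices of the other; this triple and the one
  remaining vertex, for which there are \<open>m\<close> choices, determine the configuration. Here
  \<open>s A B\<close> counts the separations of pairs in \<open>B\<close> by vertices of
  \<open>A\<close>. Hence a density far from 0 and 1 forces many separations, which near-twins do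
  not have.\<close>

lemma card_cross_edges_times_nonedges:
  fixes E :: "'v set set"
  assumes fin: "finite P" "finite Q" and m: "card P = m" "card Q = m"
  defines "s \<equiv> \<lambda>A B. \<Sum>y\<in>B. \<Sum>y'\<in>B. card (A \<inter> sym_diff (nbrs E y) (nbrs E y'))"
  shows "card (cross_edges E P Q) * card (cross_nonedges E P Q) \<le> m * s P Q + m * s Q P"
proof -
  define S1 where "S1 = (SIGMA y:Q. SIGMA y':Q. P \<inter> sym_diff (nbrs E y) (nbrs E y'))"
  define S2 where "S2 = (SIGMA x:P. SIGMA x':P. Q \<inter> sym_diff (nbrs E x) (nbrs E x'))"
  have fin1: "finite (S1 \<times> P)" unfolding S1_def using fin by (intro finite_cartesian_product finite_SigmaI) simp_all
  have fin2: "finite (S2 \<times> Q)" unfolding S2_def using fin by (intro finite_cartesian_product finite_SigmaI) simp_all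
  have c1: "card S1 = s P Q" unfolding S1_def s_def
    using fin by (subst card_SigmaI; simp add: card_SigmaI)
  have c2: "card S2 = s Q P" unfolding S2_def s_def
    using fin by (subst card_SigmaI; simp add: card_SigmaI)
  define f :: "('v \<times> 'v \<times> 'v) \<times> 'v \<Rightarrow> ('v \<times> 'v) \<times> ('v \<times> 'v)" where "f = (\<lambda>((y, y', x), x'). ((x, y), (x', y')))"
  define h :: "('v \<times> 'v \<times> 'v) \<times> 'v \<Rightarrow> ('v \<times> 'v) \<times> ('v \<times> 'v)" where "h = (\<lambda>((x, x', y'), y). ((x, y), (x', y')))"
  have "cross_edges E P Q \<times> cross_nonedges E P Q \<subseteq> f ` (S1 \<times> P) \<union> h ` (S2 \<times> Q)"
  proof
    fix p assume "p \<in> cross_edges E P Q \<times> cross_nonedges E P Q"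
    then obtain x y x' y' where p: "p = ((x, y), (x', y'))"
      and xy: "x \<in> P" "y \<in> Q" "{x, y} \<in> E" "x' \<in> P" "y' \<in> Q" "{x', y'} \<notin> E" by auto
    \<comment> \<open>The pair \<open>{x, y'}\<close> either is a nonedge, so that \<open>x\<close> separates \<open>y\<close> from \<open>y'\<close>,
      or is an edge, so that \<open>y'\<close> separates \<open>x\<close> from \<open>x'\<close>.\<close>
    show "p \<in> f ` (S1 \<times> P) \<union> h ` (S2 \<times> Q)"
    proof (cases "{x, y'} \<in> E")
      case True
      then have "((x, x', y'), y) \<in> S2 \<times> Q" using xy by (simp add: S2_def insert_commute)
      then have "h ((x, x', y'), y) \<in> h ` (S2 \<times> Q)" by (rule imageI)
      then show ?thesis by (simp add: p h_def)
    next
      case False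
      then have "((y, y', x), x') \<in> S1 \<times> P" using xy by (simp add: S1_def)
      then have "f ((y, y', x), x') \<in> f ` (S1 \<times> P)" by (rule imageI)
      then show ?thesis by (simp add: p f_def)
    qed
  qed
  then have "card (cross_edges E P Q \<times> cross_nonedges E P Q) \<le> card (f ` (S1 \<times> P) \<union> h ` (S2 \<times> Q))"
    by (rule card_mono[rotated]) (use fin1 fin2 in simp)
  also have "\<dots> \<le> card (f ` (S1 \<times> P)) + card (h ` (S2 \<times> Q))" by (rule card_Un_le)
  also have "\<dots> \<le> card (S1 \<times> P) + card (S2 \<times> Q)"
    by (intro add_mono card_image_le fin1 fin2)
  finally show ?thesis by (simp only: card_cartesian_product c1 c2 m mult.commute)
qed

lemma sum_card_Int_le:
  assumes "finite \<P>" "pairwise disjnt \<P>" "\<And>P. P \<in> \<P> \<Longrightarrow> finite P" "finite S"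
  shows "(\<Sum>P\<in>\<P>. card (P \<inter> S)) \<le> card S"
proof -
  have "(\<Sum>P\<in>\<P>. card (P \<inter> S)) = card (\<Union>P\<in>\<P>. P \<inter> S)"
  proof (rule card_UN_disjoint[symmetric])
    show "\<forall>P\<in>\<P>. \<forall>Q\<in>\<P>. P \<noteq> Q \<longrightarrow> P \<inter> S \<inter> (Q \<inter> S) = {}"
      using assms(2) by (auto simp: pairwise_def disjnt_def)
  qed (use assms in auto)
  also have "\<dots> \<le> card S" by (rule card_mono) (use assms(4) in auto)
  finally show ?thesis .
qed

text \<open>With \<open>u = card (\<Union>\<P>)\<close>, two sources contribute at most
  \<open>u ^ 2 / (4 * t ^ 2)\<close> each. Pairs inside a cluster number at most
  \<open>m * u\<close>, which the bound on \<open>m\<close> handles. Minority pairs between clusters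
  number at most \<open>16 * e * u ^ 2 / g\<close>, whence the value of \<open>g\<close>. The target
  \<open>1 / (2 * t ^ 2)\<close> is what a union bound over the pairs of \<open>t\<close> sample
  points requires.\<close>

lemma card_bad_pairs:
  fixes G :: "'v ugraph"
  assumes G: "simple_graph G"
    and P: "finite \<P>" "pairwise disjnt \<P>" "\<Union>\<P> \<subseteq> vertices G" "\<And>P. P \<in> \<P> \<Longrightarrow> card P = m" "1 \<le> m"
    and big: "card (vertices G) \<le> 2 * card (\<Union>\<P>)"
    and twins: "\<And>P x y. P \<in> \<P> \<Longrightarrow> x \<in> P \<Longrightarrow> y \<in> P \<Longrightarrow>
      g * card (sym_diff (nbrs (edges G) x) (nbrs (edges G) y)) \<le> card (vertices G)"
    and e: "1 \<le> e" and g: "g = 64 * e * t ^ 2" and m: "8 * t ^ 2 * m \<le> card (vertices G)"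
  shows "2 * t ^ 2 * card (bad_pairs (edges G) e \<P>) \<le> card (\<Union>\<P>) * card (\<Union>\<P>)"
proof -
  let ?E = "edges G" and ?n = "card (vertices G)" and ?K = "card \<P>" and ?u = "card (\<Union>\<P>)"
  let ?sd = "\<lambda>x y. sym_diff (nbrs ?E x) (nbrs ?E y)"
  have finV: "finite (vertices G)" using G by (simp add: simple_graph_def)
  have finP: "finite P" if "P \<in> \<P>" for P using P(4)[OF that] P(5) by (simp add: card_ge_0_finite)
  have "?u = sum card \<P>" by (rule card_Union_disjoint[OF P(2) finP])
  then have u: "?u = ?K * m" using P(4) by simp
  define s where "s A B = (\<Sum>y\<in>B. \<Sum>y'\<in>B. card (A \<inter> ?sd y y'))" for A B
  define Z where "Z A B = card (cross_edges ?E A B) * card (cross_nonedges ?E A B)" for A B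
  have fsd: "finite (?sd x y)" for x y
    using finite_subset[OF simple_graph_nbrs_subset[OF G] finV] by simp
  have Z_le: "Z A B \<le> m * s A B + m * s B A" if "A \<in> \<P>" "B \<in> \<P>" for A B
    unfolding Z_def s_def by (rule card_cross_edges_times_nonedges) (use that finP P(4) in auto)
  \<comment> \<open>Since the clusters are disjoint, summing over \<open>A\<close> counts each
    element of a symmetric difference at most once: a pair in \<open>B\<close> costs at most
    \<open>n / g\<close> over all clusters together.\<close>
  have s_sum: "g * (\<Sum>A\<in>\<P>. s A B) \<le> m * m * ?n" if B: "B \<in> \<P>" for B
  proof -
    have "(\<Sum>A\<in>\<P>. s A B) = (\<Sum>y\<in>B. \<Sum>A\<in>\<P>. \<Sum>y'\<in>B. card (A \<inter> ?sd y y'))"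
      unfolding s_def by (rule sum.swap)
    also have "\<dots> = (\<Sum>y\<in>B. \<Sum>y'\<in>B. \<Sum>A\<in>\<P>. card (A \<inter> ?sd y y'))"
      by (rule sum.cong[OF refl]) (rule sum.swap)
    also have "\<dots> \<le> (\<Sum>y\<in>B. \<Sum>y'\<in>B. card (?sd y y'))"
      by (intro sum_mono sum_card_Int_le P(1,2) finP fsd)
    finally have "g * (\<Sum>A\<in>\<P>. s A B) \<le> g * (\<Sum>y\<in>B. \<Sum>y'\<in>B. card (?sd y y'))"
      by (rule mult_le_mono2)
    also have "\<dots> = (\<Sum>y\<in>B. \<Sum>y'\<in>B. g * card (?sd y y'))" by (simp only: sum_distrib_left)
    also have "\<dots> \<le> (\<Sum>y\<in>B. \<Sum>y'\<in>B. ?n)" by (intro sum_mono twins[OF B])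
    also have "\<dots> = m * m * ?n" using P(4)[OF B] by simp
    finally show ?thesis .
  qed
  have Z_sum: "g * (\<Sum>A\<in>\<P>. \<Sum>B\<in>\<P>. Z A B) \<le> 2 * m * (?K * (m * m * ?n))"
  proof -
    have "(\<Sum>A\<in>\<P>. \<Sum>B\<in>\<P>. Z A B) \<le> (\<Sum>A\<in>\<P>. \<Sum>B\<in>\<P>. m * s A B + m * s B A)"
      by (intro sum_mono Z_le)
    also have "\<dots> = m * (\<Sum>A\<in>\<P>. \<Sum>B\<in>\<P>. s A B) + m * (\<Sum>A\<in>\<P>. \<Sum>B\<in>\<P>. s B A)"
      by (simp only: sum.distrib sum_distrib_left)
    also have "(\<Sum>A\<in>\<P>. \<Sum>B\<in>\<P>. s A B) = (\<Sum>A\<in>\<P>. \<Sum>B\<in>\<P>. s B A)" by (rule sum.swap)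
    finally have "g * (\<Sum>A\<in>\<P>. \<Sum>B\<in>\<P>. Z A B) \<le> g * (m * (\<Sum>A\<in>\<P>. \<Sum>B\<in>\<P>. s B A) + m * (\<Sum>A\<in>\<P>. \<Sum>B\<in>\<P>. s B A))"
      by (rule mult_le_mono2)
    also have "\<dots> = 2 * m * (g * (\<Sum>A\<in>\<P>. \<Sum>B\<in>\<P>. s B A))" by (simp add: algebra_simps)
    also have "g * (\<Sum>A\<in>\<P>. \<Sum>B\<in>\<P>. s B A) = (\<Sum>A\<in>\<P>. g * (\<Sum>B\<in>\<P>. s B A))" by (rule sum_distrib_left)
    also have "2 * m * \<dots> \<le> 2 * m * (\<Sum>A\<in>\<P>. m * m * ?n)"
      by (intro mult_le_mono2 sum_mono s_sum)
    finally show ?thesis by simp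
  qed
  \<comment> \<open>The minority pairs between \<open>P\<close> and \<open>Q\<close>; at
    intermediate densities neither kind dominates and both pieces are present.\<close>
  define B where "B P Q = (if m * m < 2 * e * card (cross_nonedges ?E P Q) then cross_edges ?E P Q else {}) \<union>
     (if m * m < 2 * e * card (cross_edges ?E P Q) then cross_nonedges ?E P Q else {})" for P Q
  have B_sub: "B P Q \<subseteq> P \<times> Q" for P Q by (auto simp: B_def)
  have finB: "finite (B P Q)" if "P \<in> \<P>" "Q \<in> \<P>" for P Q
    by (rule finite_subset[OF B_sub]) (use finP that in simp)
  have B_le: "m * m * card (B P Q) \<le> 4 * e * Z P Q" for P Q
  proof -
    let ?a = "card (cross_edges ?E P Q)" and ?b = "card (cross_nonedges ?E P Q)"
    \<comment> \<open>A kind of pair is kept only if the opposite kind numbers \<open>y\<close> with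
      \<open>m * m < 2 * e * y\<close>. So \<open>m * m\<close> may be traded for
      \<open>2 * e * y\<close>, which creates the product in \<open>Z\<close>.\<close>
    have half: "m * m * (if m * m < 2 * e * y then x else 0) \<le> 2 * e * y * x" for x y
    proof (cases "m * m < 2 * e * y")
      case True
      then have "m * m * x \<le> 2 * e * y * x" by (intro mult_le_mono1) simp
      with True show ?thesis by simp
    qed simp
    have "card (B P Q) \<le> (if m * m < 2 * e * ?b then ?a else 0) + (if m * m < 2 * e * ?a then ?b else 0)"
      unfolding B_def by (rule order_trans[OF card_Un_le]) simp
    then have "m * m * card (B P Q) \<le> m * m * ((if m * m < 2 * e * ?b then ?a else 0) + (if m * m < 2 * e * ?a then ?b else 0))"
      by (rule mult_le_mono2)
    also have "\<dots> = m * m * (if m * m < 2 * e * ?b then ?a else 0) + m * m * (if m * m < 2 * e * ?a then ?b else 0)"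
      by (rule add_mult_distrib2)
    also have "\<dots> \<le> 2 * e * ?b * ?a + 2 * e * ?a * ?b" by (intro add_mono half)
    finally show ?thesis by (simp add: Z_def algebra_simps)
  qed
  define R1 where "R1 = (\<Union>P\<in>\<P>. P \<times> P)"
  define R2 where "R2 = (\<Union>P\<in>\<P>. \<Union>Q\<in>\<P>. B P Q)"
  have sub: "bad_pairs ?E e \<P> \<subseteq> R1 \<union> R2"
  proof
    fix p assume "p \<in> bad_pairs ?E e \<P>"
    then obtain x y P Q where p: "p = (x, y)" "P \<in> \<P>" "Q \<in> \<P>" "x \<in> P" "y \<in> Q"
      and alt: "P = Q \<or> {x, y} \<in> ?E \<and> card P * card Q < 2 * e * card (cross_nonedges ?E P Q) \<or>
        {x, y} \<notin> ?E \<and> card P * card Q < 2 * e * card (cross_edges ?E P Q)"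
      unfolding bad_pairs_def by (elim CollectE case_prodE bexE conjE)
    have mm: "card P * card Q = m * m" using P(4) p by simp
    from alt show "p \<in> R1 \<union> R2"
    proof (elim disjE)
      assume "P = Q"
      then have "p \<in> P \<times> P" using p by simp
      then show ?thesis unfolding R1_def by (intro UnI1 UN_I[OF p(2)])
    next
      assume "{x, y} \<in> ?E \<and> card P * card Q < 2 * e * card (cross_nonedges ?E P Q)"
      then have "p \<in> B P Q" using p unfolding mm by (simp add: B_def)
      then show ?thesis unfolding R2_def by (intro UnI2 UN_I[OF p(2)] UN_I[OF p(3)])
    next
      assume "{x, y} \<notin> ?E \<and> card P * card Q < 2 * e * card (cross_edges ?E P Q)"
      then have "p \<in> B P Q" using p unfolding mm by (simp add: B_def)
      then show ?thesis unfolding R2_def by (intro UnI2 UN_I[OF p(2)] UN_I[OF p(3)])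
    qed
  qed
  have R1: "card R1 \<le> m * ?u"
  proof -
    have "card R1 \<le> (\<Sum>P\<in>\<P>. card (P \<times> P))" unfolding R1_def by (rule card_UN_le[OF P(1)])
    also have "\<dots> = (\<Sum>P\<in>\<P>. m * m)" using P(4) by (simp add: card_cartesian_product)
    finally show ?thesis by (simp add: u ac_simps)
  qed
  have R2: "g * card R2 \<le> 16 * e * (?u * ?u)"
  proof -
    have "card R2 \<le> (\<Sum>P\<in>\<P>. card (\<Union>Q\<in>\<P>. B P Q))" unfolding R2_def by (rule card_UN_le[OF P(1)])
    also have "\<dots> \<le> (\<Sum>P\<in>\<P>. \<Sum>Q\<in>\<P>. card (B P Q))" by (rule sum_mono) (rule card_UN_le[OF P(1)])
    finally have "m * m * card R2 \<le> m * m * (\<Sum>P\<in>\<P>. \<Sum>Q\<in>\<P>. card (B P Q))" by (rule mult_le_mono2)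
    also have "\<dots> = (\<Sum>P\<in>\<P>. \<Sum>Q\<in>\<P>. m * m * card (B P Q))" by (simp only: sum_distrib_left)
    also have "\<dots> \<le> (\<Sum>P\<in>\<P>. \<Sum>Q\<in>\<P>. 4 * e * Z P Q)" by (intro sum_mono B_le)
    also have "\<dots> = 4 * e * (\<Sum>P\<in>\<P>. \<Sum>Q\<in>\<P>. Z P Q)" by (simp only: sum_distrib_left)
    finally have "g * (m * m * card R2) \<le> g * (4 * e * (\<Sum>P\<in>\<P>. \<Sum>Q\<in>\<P>. Z P Q))" by (rule mult_le_mono2)
    also have "\<dots> = 4 * e * (g * (\<Sum>P\<in>\<P>. \<Sum>Q\<in>\<P>. Z P Q))" by (simp only: ac_simps)
    also have "\<dots> \<le> 4 * e * (2 * m * (?K * (m * m * ?n)))" using Z_sum by (rule mult_le_mono2)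
    also have "\<dots> = m * m * (8 * e * (?u * ?n))" by (simp add: u ac_simps)
    finally have "m * m * (g * card R2) \<le> m * m * (8 * e * (?u * ?n))" by (simp only: ac_simps)
    then have "g * card R2 \<le> 8 * e * (?u * ?n)" using P(5) by simp
    also have "\<dots> \<le> 8 * e * (?u * (2 * ?u))" using big by (intro mult_le_mono2)
    finally show ?thesis by (simp add: ac_simps)
  qed
  have "4 * t ^ 2 * card R2 \<le> ?u * ?u"
  proof -
    have "16 * e * (4 * t ^ 2 * card R2) \<le> 16 * e * (?u * ?u)" using R2 by (simp add: g ac_simps)
    then show ?thesis using e by (simp add: ac_simps)
  qed
  moreover have "4 * t ^ 2 * card R1 \<le> ?u * ?u"
  proof -
    have "4 * t ^ 2 * card R1 \<le> 4 * t ^ 2 * (m * ?u)" using R1 by (rule mult_le_mono2)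
    also have "\<dots> = (4 * t ^ 2 * m) * ?u" by (simp only: ac_simps)
    also have "\<dots> \<le> ?u * ?u" by (rule mult_le_mono1) (use m big in linarith)
    finally show ?thesis .
  qed
  moreover have "4 * t ^ 2 * card (bad_pairs ?E e \<P>) \<le> 4 * t ^ 2 * card R1 + 4 * t ^ 2 * card R2"
  proof -
    have "card (bad_pairs ?E e \<P>) \<le> card (R1 \<union> R2)"
      by (rule card_mono[OF _ sub]) (use P(1) finP finB in \<open>simp add: R1_def R2_def\<close>)
    also have "\<dots> \<le> card R1 + card R2" by (rule card_Un_le)
    finally have "4 * t ^ 2 * card (bad_pairs ?E e \<P>) \<le> 4 * t ^ 2 * (card R1 + card R2)" by (rule mult_le_mono2)
    then show ?thesis by (simp only: add_mult_distrib2)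
  qed
  ultimately show ?thesis by linarith
qed

text \<open>The whole argument at a fixed scale. The first sample, of size \<open>k + N\<close>,
  serves to find the clusters, and the second, of size \<open>t\<close>, is drawn from them; the two
  conditions on \<open>\<delta>\<close> keep each sample free of \<open>\<F>\<close> with
  probability at least \<open>3 / 4\<close>.\<close>

lemma homogeneous_set_exists:
  fixes G :: "nat ugraph" and \<F> :: "'f ugraph set" and \<delta> c \<epsilon> :: real
  assumes bs: "\<forall>(H::nat ugraph) Z. simple_graph H \<and> Z \<subseteq> vertices H \<and> D \<le> card Z \<and>
      shatters (edges H) (vertices H) Z \<longrightarrow> \<not> induced_free \<F> H"
    and eh: "\<forall>G :: nat ugraph. simple_graph G \<and> induced_free \<F> G \<longrightarrow>
      (\<exists>S \<subseteq> vertices G. (clique S (edges G) \<or> indep S (edges G)) \<and>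
         real (card S) \<ge> c * real (card (vertices G)) powr c)"
    and G: "simple_graph G" and \<F>: "finite \<F>"
    and e: "1 \<le> e" "1 / real e \<le> \<epsilon>" and t: "2 * real e \<le> c * real t powr c" "1 \<le> t"
    and g: "g = 64 * e * t ^ 2" and N: "1 \<le> N" and k: "k = D * N ^ D + 1"
    and kN: "4 * real (k ^ 2) * (1 - 1 / real (2 * g)) ^ N \<le> 1"
    and m: "1 \<le> m" "8 * k ^ 2 * m \<le> card (vertices G)" "8 * t ^ 2 * m \<le> card (vertices G)"
    and few: "\<And>F. F \<in> \<F> \<Longrightarrow> real (card (induced_copies F G)) \<le> \<delta> * real (card (vertices G)) ^ card (vertices F)"
    and \<delta>: "\<And>F. F \<in> \<F> \<Longrightarrow> real (card \<F>) * (4 * \<delta> * real (2 * (k + N)) ^ card (vertices F)) \<le> 1"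
      "\<And>F. F \<in> \<F> \<Longrightarrow> real (card \<F>) * (4 * \<delta> * real (2 * t) ^ card (vertices F)) \<le> 1"
  shows "\<exists>X. homogeneous \<epsilon> G X \<and> m \<le> card X"
proof -
  let ?n = "card (vertices G)" and ?E = "edges G"
  let ?sd = "\<lambda>x y. sym_diff (nbrs ?E x) (nbrs ?E y)"
  have finV: "finite (vertices G)" using G by (simp add: simple_graph_def)
  have fsd: "finite (?sd x y)" for x y
    using finite_subset[OF simple_graph_nbrs_subset[OF G] finV] by simp
  have n0: "0 < ?n"
  proof -
    have "1 \<le> 8 * t ^ 2 * m" using t(2) m(1) by simp
    with m(3) show ?thesis by linarith
  qed
  define twins where "twins C \<longleftrightarrow> (\<forall>x\<in>C. \<forall>y\<in>C. g * card (?sd x y) \<le> ?n)" for C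
  have step: "\<exists>C\<subseteq>W. card C = m \<and> twins C" if W: "W \<subseteq> vertices G" "?n \<le> 2 * card W" for W
  proof -
    have "1 \<le> 2 * g" using g e(1) t(2) by simp
    \<comment> \<open>The threshold is \<open>2 * g\<close> because members of a cluster are
      compared through the common centre \<open>v\<close>, which doubles their difference.\<close>
    have "\<exists>v\<in>W. m \<le> card {u \<in> W. 2 * g * card (?sd v u) \<le> ?n}"
      by (rule exists_many_twins[OF bs G \<F> W N \<open>1 \<le> 2 * g\<close> k kN m(1,2)], erule few, erule \<delta>(1))
    then obtain v where v: "m \<le> card {u \<in> W. 2 * g * card (?sd v u) \<le> ?n}" by (rule bexE)
    obtain C where C: "C \<subseteq> {u \<in> W. 2 * g * card (?sd v u) \<le> ?n}" "card C = m"
      by (rule obtain_subset_with_card_n[OF v])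
    have "twins C"
      unfolding twins_def
    proof (intro ballI)
      fix x y assume "x \<in> C" "y \<in> C"
      then have xy: "2 * g * card (?sd v x) \<le> ?n" "2 * g * card (?sd v y) \<le> ?n" using C(1) by auto
      have "?sd x y \<subseteq> ?sd v x \<union> ?sd v y" by auto
      then have "card (?sd x y) \<le> card (?sd v x \<union> ?sd v y)" by (rule card_mono[rotated]) (intro finite_UnI fsd)
      also have "\<dots> \<le> card (?sd v x) + card (?sd v y)" by (rule card_Un_le)
      finally have "2 * g * card (?sd x y) \<le> 2 * g * (card (?sd v x) + card (?sd v y))" by (rule mult_le_mono2)
      also have "\<dots> = 2 * g * card (?sd v x) + 2 * g * card (?sd v y)" by (rule add_mult_distrib2)
      also have "\<dots> \<le> 2 * ?n" using xy by linarith
      finally show "g * card (?sd x y) \<le> ?n" by simp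
    qed
    moreover have "C \<subseteq> W" using C(1) by auto
    ultimately show ?thesis using C(2) by (intro exI conjI)
  qed
  obtain \<P> where P: "finite \<P>" "pairwise disjnt \<P>" "\<Union>\<P> \<subseteq> vertices G" "?n \<le> 2 * card (\<Union>\<P>)"
    "\<And>C. C \<in> \<P> \<Longrightarrow> card C = m" "\<And>C. C \<in> \<P> \<Longrightarrow> twins C"
    using maximal_disjoint_family[OF finV m(1) step] by metis
  let ?U = "\<Union>\<P>"
  define R where "R = bad_pairs ?E e \<P>"
  have R_card: "2 * t ^ 2 * card R \<le> card ?U * card ?U"
    unfolding R_def
    by (rule card_bad_pairs[OF G P(1,2,3) _ m(1) P(4) _ e(1) g m(3)])
      (erule P(5), use P(6) in \<open>simp add: twins_def\<close>)
  have R_sub: "R \<subseteq> ?U \<times> ?U" by (auto simp: R_def bad_pairs_def)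
  have finU: "finite ?U" using finite_subset[OF P(3) finV] .
  have U0: "0 < card ?U" using n0 P(4) by linarith
  \<comment> \<open>All points are drawn from the whole union. No cluster has to be assigned in
    advance: a sample without bad pairs meets each cluster at most once.\<close>
  define \<Omega> where "\<Omega> = PiE {..<t} (\<lambda>_. ?U)"
  have fin\<Omega>: "finite \<Omega>" unfolding \<Omega>_def by (rule finite_PiE) (simp_all add: finU)
  have "?U \<noteq> {}" using U0 by (metis card.empty less_irrefl)
  then have \<Omega>ne: "\<Omega> \<noteq> {}" unfolding \<Omega>_def by (simp only: PiE_eq_empty_iff) simp
  define J where "J = {(a, b) \<in> {..<t} \<times> {..<t}. a \<noteq> b}"
  define Bad where "Bad p f \<longleftrightarrow> (f (fst p), f (snd p)) \<in> R" for p :: "nat \<times> nat" and f :: "nat \<Rightarrow> nat"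
  have J: "finite J" "real (card J) \<le> real (t ^ 2)"
  proof -
    have sub: "J \<subseteq> {..<t} \<times> {..<t}" by (auto simp: J_def)
    show "finite J" by (rule finite_subset[OF sub]) simp
    have "card J \<le> card ({..<t} \<times> {..<t})" by (rule card_mono[OF _ sub]) simp
    then show "real (card J) \<le> real (t ^ 2)" by (intro of_nat_mono) (simp add: power2_eq_square)
  qed
  have bad: "2 * real (t ^ 2) * real (card {f \<in> \<Omega>. Bad p f}) \<le> real (card \<Omega>)" if p: "p \<in> J" for p
  proof -
    obtain a b where ab: "p = (a, b)" "a < t" "b < t" "a \<noteq> b" using p by (auto simp: J_def)
    let ?u = "real (card ?U)" and ?b = "real (card {f \<in> \<Omega>. Bad p f})"
    have "real (card {f \<in> PiE {..<t} (\<lambda>_. ?U). (f a, f b) \<in> R \<and> (\<forall>i\<in>{}. f i \<in> UNIV)}) * (?u * ?u)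
        \<le> real (card R) * 0 ^ card ({} :: nat set) * real (card (PiE {..<t} (\<lambda>_. ?U)))"
      by (rule card_PiE_pair_event[where D = "\<lambda>_ _. UNIV" and A = "\<lambda>_. ?U"])
        (simp_all only: ab finU R_sub finite_lessThan lessThan_iff empty_subsetI empty_iff order_refl simp_thms)
    then have 1: "?b * (?u * ?u) \<le> real (card R) * real (card \<Omega>)"
      by (simp add: Bad_def ab(1) \<Omega>_def)
    have "real (2 * t ^ 2 * card R) \<le> real (card ?U * card ?U)" using R_card by (rule of_nat_mono)
    then have 2: "2 * real (t ^ 2) * real (card R) \<le> ?u * ?u" by (simp only: of_nat_mult of_nat_numeral)
    have "(?u * ?u) * (2 * real (t ^ 2) * ?b) = 2 * real (t ^ 2) * (?b * (?u * ?u))" by (simp only: ac_simps)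
    also have "\<dots> \<le> 2 * real (t ^ 2) * (real (card R) * real (card \<Omega>))" using 1 by (rule mult_left_mono) simp
    also have "\<dots> = (2 * real (t ^ 2) * real (card R)) * real (card \<Omega>)" by (simp only: ac_simps)
    also have "\<dots> \<le> (?u * ?u) * real (card \<Omega>)" using 2 by (rule mult_right_mono) simp
    finally have "(?u * ?u) * (2 * real (t ^ 2) * ?b) \<le> (?u * ?u) * real (card \<Omega>)" .
    moreover have "0 < ?u * ?u" using U0 by simp
    ultimately show ?thesis by (simp only: mult_le_cancel_left_pos)
  qed
  have free: "4 * real (card {f \<in> \<Omega>. \<not> induced_free \<F> (induced G (f ` {..<t}))}) \<le> real (card \<Omega>)"
    unfolding \<Omega>_def
  proof (rule card_PiE_not_induced_free[OF finV _ \<F> finite_lessThan P(3) P(4) few])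
    show "vertices G \<noteq> {}" using n0 by auto
    show "real (card \<F>) * (4 * \<delta> * real (2 * card {..<t}) ^ card (vertices F)) \<le> 1" if "F \<in> \<F>" for F
      using \<delta>(2)[OF that] by (simp only: card_lessThan)
  qed
  have "\<exists>f\<in>\<Omega>. \<not> \<not> induced_free \<F> (induced G (f ` {..<t})) \<and> (\<forall>p\<in>J. \<not> Bad p f)"
    by (rule exists_avoiding_events[OF fin\<Omega> \<Omega>ne J _ free]) (rule bad)
  then obtain f where f: "f \<in> \<Omega>" "\<not> \<not> induced_free \<F> (induced G (f ` {..<t}))"
      and good: "\<forall>p\<in>J. \<not> Bad p f"
    by (elim bexE conjE)
  have fU: "f i \<in> ?U" if "i < t" for i using f(1) that by (simp add: \<Omega>_def PiE_iff)
  have good': "(f a, f b) \<notin> R" if "a < t" "b < t" "a \<noteq> b" for a b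
  proof -
    have "(a, b) \<in> J" using that by (simp add: J_def)
    from good[rule_format, OF this] show ?thesis by (simp add: Bad_def)
  qed
  \<comment> \<open>Equal values lie in a common cluster and would form a bad pair. Thus the sampled
    graph has exactly \<open>t\<close> vertices, as the lower bound from the Erdos--Hajnal property
    requires.\<close>
  have inj: "inj_on f {..<t}"
  proof (rule inj_onI, rule ccontr)
    fix a b assume ab: "a \<in> {..<t}" "b \<in> {..<t}" "f a = f b" "a \<noteq> b"
    obtain P where "P \<in> \<P>" "f a \<in> P" using fU[of a] ab(1) by auto
    then have "(f a, f b) \<in> R" unfolding R_def ab(3)[symmetric] by (intro mem_bad_pairsI[of P \<P> P]) simp_all
    with good'[of a b] ab show False by simp
  qed
  let ?H = "induced G (f ` {..<t})"
  have fV: "f ` {..<t} \<subseteq> vertices G" using fU P(3) by (intro image_subsetI) (simp only: lessThan_iff subsetD)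
  have "simple_graph ?H" by (rule simple_graph_induced[OF G fV])
  moreover have "induced_free \<F> ?H" using f(2) by simp
  ultimately have "\<exists>S \<subseteq> vertices ?H. (clique S (edges ?H) \<or> indep S (edges ?H)) \<and>
      real (card S) \<ge> c * real (card (vertices ?H)) powr c"
    by (intro eh[rule_format] conjI)
  then obtain S where S: "S \<subseteq> vertices ?H" "clique S (edges ?H) \<or> indep S (edges ?H)"
      "c * real (card (vertices ?H)) powr c \<le> real (card S)"
    by (elim exE conjE)
  have S_sub: "S \<subseteq> f ` {..<t}" using S(1) by (simp add: induced_def)
  have "card (vertices ?H) = t" using inj by (simp add: induced_def card_image)
  then have "real (2 * e) \<le> real (card S)" using S(3) t(1) by simp
  then have cS: "2 * e \<le> card S" by (simp only: of_nat_le_iff)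
  have S_hom: "clique S ?E \<or> indep S ?E"
    using S(2)
  proof
    assume "clique S (edges ?H)"
    then have "clique S ?E" by (simp add: clique_def induced_def)
    then show ?thesis ..
  next
    assume ind: "indep S (edges ?H)"
    have "indep S ?E"
      unfolding indep_def
    proof (intro ballI impI)
      fix v w assume vw: "v \<in> S" "w \<in> S" "v \<noteq> w"
      then have "{v, w} \<notin> edges ?H" using ind by (simp add: indep_def)
      then show "{v, w} \<notin> ?E" using subsetD[OF S_sub vw(1)] subsetD[OF S_sub vw(2)] by (simp add: induced_def)
    qed
    then show ?thesis ..
  qed
  show ?thesis
  proof (rule homogeneous_union[OF G P(1,2,3) _ m(1) e _ _ cS S_hom])
    show "S \<subseteq> ?U" using S_sub fU by (intro subsetI) auto
    show "finite S" by (rule finite_subset[OF S_sub]) simp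
    fix x y assume xy: "x \<in> S" "y \<in> S" "x \<noteq> y"
    obtain a b where "x = f a" "y = f b" "a < t" "b < t"
      using subsetD[OF S_sub xy(1)] subsetD[OF S_sub xy(2)] by auto
    moreover have "a \<noteq> b" using calculation xy(3) by auto
    ultimately show "(x, y) \<notin> bad_pairs ?E e \<P>" using good'[of a b] by (simp add: R_def)
  qed (rule P(5))
qed

section \<open>Polynomial bounds\<close>

text \<open>For \<open>e \<ge> 1\<close> a monomial increases with its exponent, so one monomial
  dominates a sum and closure under addition is easy.\<close>

definition poly_bounded :: "(nat \<Rightarrow> nat) \<Rightarrow> bool" where
  "poly_bounded h \<longleftrightarrow> (\<exists>A B. \<forall>e\<ge>1. h e \<le> A * e ^ B)"

lemma poly_boundedE:
  assumes "poly_bounded h"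
  obtains A B where "\<forall>e\<ge>1. h e \<le> A * e ^ B"
  using assms unfolding poly_bounded_def by (elim exE)

lemma poly_boundedI: "(\<And>e. 1 \<le> e \<Longrightarrow> h e \<le> A * e ^ B) \<Longrightarrow> poly_bounded h"
  unfolding poly_bounded_def by (intro exI allI impI)

lemma poly_bounded_const [intro]: "poly_bounded (\<lambda>e. a)"
  by (rule poly_boundedI[of _ a 0]) simp

lemma poly_bounded_id [intro]: "poly_bounded (\<lambda>e. e)"
  by (rule poly_boundedI[of _ 1 1]) simp

lemma poly_bounded_mult [intro]:
  assumes "poly_bounded h" "poly_bounded h'"
  shows "poly_bounded (\<lambda>e. h e * h' e)"
proof -
  obtain A B where 1: "\<forall>e\<ge>1. h e \<le> A * e ^ B" by (rule poly_boundedE[OF assms(1)])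
  obtain A' B' where 2: "\<forall>e\<ge>1. h' e \<le> A' * e ^ B'" by (rule poly_boundedE[OF assms(2)])
  show ?thesis
  proof (rule poly_boundedI)
    fix e :: nat assume "1 \<le> e"
    then have "h e * h' e \<le> (A * e ^ B) * (A' * e ^ B')" using 1 2 by (intro mult_le_mono) simp_all
    also have "\<dots> = (A * A') * e ^ (B + B')" by (simp add: power_add ac_simps)
    finally show "h e * h' e \<le> (A * A') * e ^ (B + B')" .
  qed
qed

lemma poly_bounded_add [intro]:
  assumes "poly_bounded h" "poly_bounded h'"
  shows "poly_bounded (\<lambda>e. h e + h' e)"
proof -
  obtain A B where 1: "\<forall>e\<ge>1. h e \<le> A * e ^ B" by (rule poly_boundedE[OF assms(1)])
  obtain A' B' where 2: "\<forall>e\<ge>1. h' e \<le> A' * e ^ B'" by (rule poly_boundedE[OF assms(2)])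
  show ?thesis
  proof (rule poly_boundedI)
    fix e :: nat assume e: "1 \<le> e"
    have "h e \<le> A * e ^ (B + B')"
      by (rule order_trans[OF 1[rule_format, OF e]]) (use e in \<open>intro mult_le_mono2 power_increasing, simp_all\<close>)
    moreover have "h' e \<le> A' * e ^ (B + B')"
      by (rule order_trans[OF 2[rule_format, OF e]]) (use e in \<open>intro mult_le_mono2 power_increasing, simp_all\<close>)
    ultimately show "h e + h' e \<le> (A + A') * e ^ (B + B')" by (simp add: add_mult_distrib)
  qed
qed

lemma poly_bounded_power [intro]:
  assumes "poly_bounded h"
  shows "poly_bounded (\<lambda>e. h e ^ p)"
  by (induction p) (use assms in auto)

text \<open>Solving \<open>2 * e \<le> c * t powr c\<close> gives
  \<open>t \<ge> (2 * e / c) powr (1 / c)\<close>; coefficient and exponent are rounded up to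
  integers.\<close>

lemma poly_bounded_powr_lower:
  fixes c :: real
  assumes "0 < c"
  shows "\<exists>t. poly_bounded t \<and> (\<forall>e\<ge>1. 1 \<le> t e \<and> 2 * real e \<le> c * real (t e) powr c)"
proof -
  define A where "A = nat \<lceil>(2 / c) powr (1 / c)\<rceil>"
  define B where "B = nat \<lceil>1 / c\<rceil>"
  have pos: "0 < (2 / c) powr (1 / c)" using assms by simp
  have A: "(2 / c) powr (1 / c) \<le> real A" unfolding A_def by (rule real_nat_ceiling_ge)
  have B: "1 / c \<le> real B" unfolding B_def by (rule real_nat_ceiling_ge)
  have "1 \<le> A * e ^ B \<and> 2 * real e \<le> c * real (A * e ^ B) powr c" if e: "1 \<le> e" for e
  proof
    have "0 < real A" using pos A by linarith
    then show "1 \<le> A * e ^ B" using e by (simp add: Suc_le_eq)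
    have "real e powr (1 / c) \<le> real e powr real B" using B e by (intro powr_mono) simp_all
    also have "\<dots> = real (e ^ B)" using e by (simp add: powr_realpow)
    finally have "(2 / c) powr (1 / c) * real e powr (1 / c) \<le> real A * real (e ^ B)"
      using A by (intro mult_mono) simp_all
    then have "((2 / c) powr (1 / c) * real e powr (1 / c)) powr c \<le> (real A * real (e ^ B)) powr c"
      using assms by (intro powr_mono2) simp_all
    also have "((2 / c) powr (1 / c) * real e powr (1 / c)) powr c = (2 / c) * real e"
      using assms e by (simp add: powr_mult powr_powr)
    finally have "c * ((2 / c) * real e) \<le> c * (real A * real (e ^ B)) powr c"
      using assms by (intro mult_left_mono) simp_all
    then show "2 * real e \<le> c * real (A * e ^ B) powr c" using assms by simp
  qed
  moreover have "poly_bounded (\<lambda>e. A * e ^ B)" by (rule poly_boundedI[of _ A B]) simp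
  ultimately show ?thesis by (intro exI[of _ "\<lambda>e. A * e ^ B"] conjI allI impI) simp_all
qed

lemma power_div_fact_le_exp:
  fixes x :: real
  assumes "0 \<le> x"
  shows "x ^ p / fact p \<le> exp x"
proof -
  have "(\<Sum>n\<in>{p}. x ^ n / fact n) \<le> (\<Sum>n. x ^ n / fact n)"
    using summable_exp_generic[of x] assms
    by (intro sum_le_suminf) (simp_all add: scaleR_conv_of_real field_simps)
  then show ?thesis by (simp add: exp_def scaleR_conv_of_real field_simps)
qed

text \<open>With \<open>N = C * \<gamma> ^ 2\<close> the power is at most
  \<open>exp (- (C * \<gamma>))\<close>, and the polynomial factor is at most one term of the series
  of \<open>exp (C * \<gamma>)\<close>. The square is essential to this comparison: with
  \<open>N\<close> linear in \<open>\<gamma>\<close> the exponential would be a constant.\<close>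

lemma exists_separating_sample_size:
  "\<exists>C\<ge>1. \<forall>\<gamma>\<ge>1. 4 * real ((D * (C * \<gamma> ^ 2) ^ D + 1) ^ 2) * (1 - 1 / real \<gamma>) ^ (C * \<gamma> ^ 2) \<le> 1"
proof -
  \<comment> \<open>The factor \<open>4 * k ^ 2\<close> has degree \<open>2 * D\<close> in
    \<open>N\<close>, hence \<open>4 * D\<close> in \<open>\<gamma>\<close>. The constants
    \<open>4 * (D + 1) ^ 2 * fact p\<close> are exactly \<open>C\<close>, so they cost one further
    power of \<open>C\<close>, and \<open>2 * D + 1 \<le> p\<close>.\<close>
  define p where "p = 4 * D + 1"
  define C :: nat where "C = 4 * (D + 1) ^ 2 * fact p"
  have C1: "1 \<le> C" by (simp add: C_def Suc_le_eq)
  have "4 * real ((D * (C * \<gamma> ^ 2) ^ D + 1) ^ 2) * (1 - 1 / real \<gamma>) ^ (C * \<gamma> ^ 2) \<le> 1" if \<gamma>: "1 \<le> \<gamma>" for \<gamma>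
  proof -
    let ?N = "C * \<gamma> ^ 2"
    have "1 \<le> ?N" using C1 \<gamma> by simp
    then have N1: "1 \<le> ?N ^ D" by (rule one_le_power)
    have "(1 - 1 / real \<gamma>) ^ ?N \<le> exp (- (1 / real \<gamma>)) ^ ?N"
      using exp_ge_add_one_self[of "- (1 / real \<gamma>)"] \<gamma> by (intro power_mono) simp_all
    also have "\<dots> = exp (real ?N * (- (1 / real \<gamma>)))" by (rule exp_of_nat_mult[symmetric])
    also have "real ?N * (- (1 / real \<gamma>)) = - real (C * \<gamma>)" using \<gamma> by (simp add: power2_eq_square)
    finally have 1: "(1 - 1 / real \<gamma>) ^ ?N \<le> exp (- real (C * \<gamma>))" .
    have "D * ?N ^ D + 1 \<le> (D + 1) * ?N ^ D" using N1 by simp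
    then have "(D * ?N ^ D + 1) ^ 2 \<le> ((D + 1) * ?N ^ D) ^ 2" by (rule power_mono) simp
    then have "4 * (D * ?N ^ D + 1) ^ 2 * fact p \<le> 4 * ((D + 1) * ?N ^ D) ^ 2 * fact p" by simp
    also have "4 * ((D + 1) * M) ^ 2 * fact p = C * M ^ 2" for M
      by (simp only: C_def power_mult_distrib ac_simps)
    also have "(?N ^ D) ^ 2 = C ^ (2 * D) * \<gamma> ^ (4 * D)"
      by (simp add: power_mult_distrib power_mult[symmetric] mult.commute)
    also have "C * (C ^ (2 * D) * \<gamma> ^ (4 * D)) \<le> C ^ p * \<gamma> ^ p"
    proof -
      have "C ^ Suc (2 * D) \<le> C ^ p" using C1 by (intro power_increasing) (simp_all add: p_def)
      moreover have "\<gamma> ^ (4 * D) \<le> \<gamma> ^ p" using \<gamma> by (intro power_increasing) (simp_all add: p_def)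
      ultimately have "C ^ Suc (2 * D) * \<gamma> ^ (4 * D) \<le> C ^ p * \<gamma> ^ p" by (rule mult_le_mono)
      then show ?thesis by (simp add: ac_simps)
    qed
    finally have "4 * (D * ?N ^ D + 1) ^ 2 * fact p \<le> (C * \<gamma>) ^ p" by (simp only: power_mult_distrib)
    then have "real (4 * (D * ?N ^ D + 1) ^ 2 * fact p) \<le> real ((C * \<gamma>) ^ p)" by (rule of_nat_mono)
    then have "4 * real ((D * ?N ^ D + 1) ^ 2) * fact p \<le> real (C * \<gamma>) ^ p"
      by (simp only: of_nat_mult of_nat_numeral of_nat_power of_nat_fact)
    then have "4 * real ((D * ?N ^ D + 1) ^ 2) \<le> real (C * \<gamma>) ^ p / fact p"
      by (simp only: pos_le_divide_eq[OF fact_gt_zero])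
    also have "\<dots> \<le> exp (real (C * \<gamma>))" by (rule power_div_fact_le_exp) simp
    finally have 2: "4 * real ((D * ?N ^ D + 1) ^ 2) \<le> exp (real (C * \<gamma>))" .
    have "0 \<le> (1 - 1 / real \<gamma>) ^ ?N" using \<gamma> by simp
    then have "4 * real ((D * ?N ^ D + 1) ^ 2) * (1 - 1 / real \<gamma>) ^ ?N \<le> exp (real (C * \<gamma>)) * exp (- real (C * \<gamma>))"
      using 1 2 by (intro mult_mono) simp_all
    also have "\<dots> = 1" by (simp only: exp_add[symmetric]) simp
    finally show ?thesis .
  qed
  with C1 show ?thesis by (intro exI conjI allI impI)
qed

lemma inverse_poly_bounded_lower:
  assumes "poly_bounded h" and pos: "\<And>e. 1 \<le> e \<Longrightarrow> 1 \<le> h e"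
  shows "\<exists>a b :: real. a > 0 \<and> b > 0 \<and>
    (\<forall>\<epsilon>. 0 < \<epsilon> \<and> \<epsilon> \<le> 1 \<longrightarrow> a * \<epsilon> powr b \<le> 1 / real (h (nat \<lceil>1 / \<epsilon>\<rceil>)))"
proof -
  obtain A B where AB: "\<forall>e\<ge>1. h e \<le> A * e ^ B" by (rule poly_boundedE[OF assms(1)])
  \<comment> \<open>As \<open>\<epsilon> \<le> 1\<close>, rounding \<open>1 / \<epsilon>\<close> up
    at most doubles it, which gives the factor \<open>2 ^ (B + 1)\<close>. The exponent
    \<open>B + 1\<close> is positive even if \<open>B = 0\<close>.\<close>
  define a where "a = 1 / (real (A + 1) * 2 ^ (B + 1))"
  have "a * \<epsilon> powr real (B + 1) \<le> 1 / real (h (nat \<lceil>1 / \<epsilon>\<rceil>))" if \<epsilon>: "0 < \<epsilon>" "\<epsilon> \<le> 1" for \<epsilon>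
  proof -
    let ?e = "nat \<lceil>1 / \<epsilon>\<rceil>"
    have "1 \<le> 1 / \<epsilon>" using \<epsilon> by simp
    moreover have "1 / \<epsilon> \<le> real ?e" by (rule real_nat_ceiling_ge)
    ultimately have e1: "1 \<le> ?e" by linarith
    have e2: "real ?e \<le> 2 / \<epsilon>" using \<open>1 \<le> 1 / \<epsilon>\<close> by linarith
    have "h ?e \<le> A * ?e ^ B" using AB e1 by simp
    also have "\<dots> \<le> (A + 1) * ?e ^ (B + 1)" using e1 by (intro mult_le_mono power_increasing) simp_all
    finally have "real (h ?e) \<le> real ((A + 1) * ?e ^ (B + 1))" by (rule of_nat_mono)
    also have "\<dots> = real (A + 1) * real ?e ^ (B + 1)" by (simp only: of_nat_mult of_nat_power)
    also have "\<dots> \<le> real (A + 1) * (2 / \<epsilon>) ^ (B + 1)"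
      using e2 by (intro mult_left_mono power_mono) simp_all
    finally have le: "real (h ?e) \<le> real (A + 1) * (2 / \<epsilon>) ^ (B + 1)" .
    have "a * \<epsilon> powr real (B + 1) = a * \<epsilon> ^ (B + 1)" using \<epsilon> by (simp only: powr_realpow)
    also have "\<dots> = 1 / (real (A + 1) * (2 / \<epsilon>) ^ (B + 1))"
      by (simp add: a_def power_divide)
    also have "\<dots> \<le> 1 / real (h ?e)" by (rule frac_le[OF _ order_refl _ le]) (use pos[OF e1] in simp_all)
    finally show ?thesis .
  qed
  moreover have "0 < a" by (simp add: a_def)
  ultimately show ?thesis by (intro exI[of _ a] exI[of _ "real (B + 1)"]) simp
qed

theorem theorem1p1:
  fixes \<F> :: "'f ugraph set"
  assumes "finite \<F>"
    and "\<forall>F\<in>\<F>. simple_graph F"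
    and "\<exists>F\<in>\<F>. bipartite F"
    and "\<exists>F\<in>\<F>. cobipartite F"
    and "\<exists>F\<in>\<F>. split_graph F"
    and "erdos_hajnal \<F>"
  shows "\<exists>(a::real) (b::real). a > 0 \<and> b > 0 \<and>
    (\<forall>\<epsilon>::real. 0 < \<epsilon> \<and> \<epsilon> \<le> 1 \<longrightarrow>
      (\<exists>\<delta>::real. \<delta> \<ge> a * \<epsilon> powr b \<and> \<delta> > 0 \<and>
        (\<forall>G :: nat ugraph.
           simple_graph G \<and> real (card (vertices G)) \<ge> 1 / \<delta> \<and>
           (\<forall>F\<in>\<F>. real (card (induced_copies F G))
                     < \<delta> * real (card (vertices G)) ^ card (vertices F)) \<longrightarrow>
           (\<exists>X. homogeneous \<epsilon> G X \<and> real (card X) \<ge> \<delta> * real (card (vertices G))))))"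
proof -
  obtain D where D: "\<forall>(H::nat ugraph) Z. simple_graph H \<and> Z \<subseteq> vertices H \<and> D \<le> card Z \<and>
      shatters (edges H) (vertices H) Z \<longrightarrow> \<not> induced_free \<F> H"
    using bounded_shattering[OF assms(2-5)] by (rule exE)
  obtain c :: real where c: "0 < c" and eh: "\<forall>G :: nat ugraph. simple_graph G \<and> induced_free \<F> G \<longrightarrow>
      (\<exists>S \<subseteq> vertices G. (clique S (edges G) \<or> indep S (edges G)) \<and>
         real (card S) \<ge> c * real (card (vertices G)) powr c)"
    using assms(6) unfolding erdos_hajnal_def by (elim exE conjE)
  obtain t where t: "poly_bounded t" "\<forall>e\<ge>1. 1 \<le> t e \<and> 2 * real e \<le> c * real (t e) powr c"
    using poly_bounded_powr_lower[OF c] by (elim exE conjE)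
  obtain C where C: "1 \<le> C"
    "\<forall>\<gamma>\<ge>1. 4 * real ((D * (C * \<gamma> ^ 2) ^ D + 1) ^ 2) * (1 - 1 / real \<gamma>) ^ (C * \<gamma> ^ 2) \<le> 1"
    using exists_separating_sample_size[of D] by (elim exE conjE)
  define g where "g e = 64 * e * t e ^ 2" for e
  define N where "N e = C * (2 * g e) ^ 2" for e
  define k where "k e = D * N e ^ D + 1" for e
  \<comment> \<open>A common bound for the sizes \<open>k + N\<close> and \<open>t\<close> of the
    two samples.\<close>
  define L where "L e = k e + N e + t e" for e
  define f where "f = (\<Sum>F\<in>\<F>. card (vertices F))"
  \<comment> \<open>The reciprocal of \<open>\<delta>\<close>. Since \<open>f\<close> is at least
    the order of every member, \<open>(2 * L e) ^ f\<close> covers the copy conditions, and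
    \<open>card \<F>\<close> comes from the union bound over members. Two more powers and the factor
    16 ensure \<open>16 * L e ^ 2 \<le> h e\<close>, needed for the cluster size.\<close>
  define h where "h e = 16 * (card \<F> + 1) * (2 * L e) ^ (f + 2)" for e
  have poly: "poly_bounded h"
    unfolding h_def L_def k_def N_def g_def by (intro poly_bounded_mult poly_bounded_add poly_bounded_power
      poly_bounded_const poly_bounded_id t(1))
  have L1: "1 \<le> L e" for e by (simp add: L_def k_def)
  have h1: "1 \<le> h e" for e using L1[of e] by (simp add: h_def Suc_le_eq)
  have "\<exists>a b :: real. a > 0 \<and> b > 0 \<and>
      (\<forall>\<epsilon>. 0 < \<epsilon> \<and> \<epsilon> \<le> 1 \<longrightarrow> a * \<epsilon> powr b \<le> 1 / real (h (nat \<lceil>1 / \<epsilon>\<rceil>)))"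
    by (rule inverse_poly_bounded_lower[OF poly h1])
  then obtain a b :: real where ab: "a > 0" "b > 0"
    "\<forall>\<epsilon>. 0 < \<epsilon> \<and> \<epsilon> \<le> 1 \<longrightarrow> a * \<epsilon> powr b \<le> 1 / real (h (nat \<lceil>1 / \<epsilon>\<rceil>))"
    by (elim exE conjE)
  have main: "\<exists>X. homogeneous \<epsilon> G X \<and> 1 / real (h (nat \<lceil>1 / \<epsilon>\<rceil>)) * real (card (vertices G)) \<le> real (card X)"
    if \<epsilon>: "0 < \<epsilon>" "\<epsilon> \<le> 1" and G: "simple_graph G"
      and big: "1 / (1 / real (h (nat \<lceil>1 / \<epsilon>\<rceil>))) \<le> real (card (vertices G))"
      and few: "\<forall>F\<in>\<F>. real (card (induced_copies F G))
          < 1 / real (h (nat \<lceil>1 / \<epsilon>\<rceil>)) * real (card (vertices G)) ^ card (vertices F)"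
    for \<epsilon> :: real and G :: "nat ugraph"
  proof -
    define e where "e = nat \<lceil>1 / \<epsilon>\<rceil>"
    let ?n = "card (vertices G)" and ?\<delta> = "1 / real (h e)"
    have e_ge: "1 / \<epsilon> \<le> real e" unfolding e_def by (rule real_nat_ceiling_ge)
    moreover have "1 \<le> 1 / \<epsilon>" using \<epsilon> by simp
    ultimately have e1: "1 \<le> e" by linarith
    have e\<epsilon>: "1 / real e \<le> \<epsilon>" using e_ge \<epsilon>(1) e1 by (simp add: field_simps)
    have te: "1 \<le> t e" "2 * real e \<le> c * real (t e) powr c" using t(2) e1 by simp_all
    have g1: "1 \<le> 2 * g e" using e1 te(1) by (simp add: g_def)
    then have "1 \<le> (2 * g e) ^ 2" by (rule one_le_power)
    then have N1: "1 \<le> N e" using C(1) unfolding N_def by (metis mult_le_mono mult_1)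
    have kN: "4 * real (k e ^ 2) * (1 - 1 / real (2 * g e)) ^ N e \<le> 1"
      using C(2)[rule_format, OF g1] unfolding k_def N_def .
    \<comment> \<open>The cluster size is \<open>m = ?n div q\<close>. From
      \<open>?n \<ge> h e \<ge> q\<close> it is positive, so rounding down loses at most a factor 2:
      \<open>?n < q * (m + 1) \<le> 2 * q * m \<le> h e * m\<close>, that is,
      \<open>\<delta> * n \<le> m\<close>.\<close>
    define q where "q = 8 * L e ^ 2"
    define m where "m = ?n div q"
    have q1: "1 \<le> q" using L1[of e] by (simp add: q_def)
    have hn: "h e \<le> ?n" using big by (simp add: e_def)
    have q_h: "2 * q \<le> h e"
    proof -
      have "2 * q = 4 * (2 * L e) ^ 2 * 1" by (simp add: q_def power_mult_distrib)
      also have "\<dots> \<le> 16 * (card \<F> + 1) * (2 * L e) ^ 2 * (2 * L e) ^ f"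
        using L1[of e] by (intro mult_le_mono) (simp_all add: Suc_le_eq)
      also have "\<dots> = h e" by (simp only: h_def power_add ac_simps)
      finally show ?thesis .
    qed
    have mn: "q * m \<le> ?n" unfolding m_def by (rule times_div_less_eq_dividend)
    have m1: "1 \<le> m"
    proof -
      have "q \<le> ?n" using q_h hn by linarith
      then have "q div q \<le> ?n div q" by (rule div_le_mono)
      then show ?thesis using q1 by (simp add: m_def)
    qed
    have sq: "8 * x ^ 2 * m \<le> ?n" if "x \<le> L e" for x
    proof -
      have "8 * x ^ 2 * m \<le> q * m" unfolding q_def using that by (intro mult_le_mono power_mono) simp_all
      then show ?thesis using mn by (rule order_trans)
    qed
    have \<delta>: "real (card \<F>) * (4 * ?\<delta> * real (2 * x) ^ card (vertices F)) \<le> 1"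
      if F: "F \<in> \<F>" and x: "x \<le> L e" for F x
    proof -
      have "card (vertices F) \<le> f"
        unfolding f_def using assms(1) F by (intro member_le_sum) simp_all
      then have "(2 * x) ^ card (vertices F) \<le> (2 * L e) ^ (f + 2)"
        using x L1[of e]
        by (intro order_trans[OF power_mono[of "2 * x" "2 * L e"] power_increasing]) simp_all
      then have "card \<F> * 4 * (2 * x) ^ card (vertices F) \<le> h e"
        unfolding h_def by (rule mult_le_mono[rotated]) simp
      then have "real (card \<F> * 4 * (2 * x) ^ card (vertices F)) \<le> real (h e)" by (rule of_nat_mono)
      then have "real (card \<F>) * 4 * real (2 * x) ^ card (vertices F) \<le> real (h e)"
        by (simp only: of_nat_mult of_nat_numeral of_nat_power)
      moreover have "0 < real (h e)" using h1[of e] by simp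
      ultimately have "real (card \<F>) * 4 * real (2 * x) ^ card (vertices F) / real (h e) \<le> 1"
        by (simp only: pos_divide_le_eq mult_1)
      then show ?thesis by (simp add: ac_simps)
    qed
    have few': "real (card (induced_copies F G)) \<le> ?\<delta> * real ?n ^ card (vertices F)" if "F \<in> \<F>" for F
      using few[rule_format, OF that] unfolding e_def by (rule less_imp_le)
    have "\<exists>X. homogeneous \<epsilon> G X \<and> m \<le> card X"
      by (rule homogeneous_set_exists[where \<delta> = ?\<delta>, OF D eh G assms(1) e1 e\<epsilon> te(2,1) g_def N1 k_def kN m1])
        (simp_all only: few' \<delta> sq L_def trans_le_add1 le_add2 le_add1 order_refl)
    then obtain X where X: "homogeneous \<epsilon> G X" "m \<le> card X" by (elim exE conjE)
    have "?n < q * (m + 1)"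
    proof -
      have "?n = q * m + ?n mod q" by (simp add: m_def)
      also have "\<dots> < q * m + q" using q1 by simp
      finally show ?thesis by simp
    qed
    also have "\<dots> \<le> 2 * q * m" using m1 by simp
    also have "\<dots> \<le> h e * card X" using q_h X(2) by (rule mult_le_mono)
    finally have "real ?n \<le> real (h e * card X)" by (intro of_nat_mono less_imp_le)
    then have "?\<delta> * real ?n \<le> real (card X)"
      using h1[of e] by (simp add: pos_divide_le_eq mult.commute Suc_le_eq)
    with X(1) show ?thesis unfolding e_def by (intro exI conjI)
  qed
  show ?thesis
  proof (rule exI[of _ a], rule exI[of _ b], intro conjI allI impI)
    show "a > 0" "b > 0" by (fact ab)+
    fix \<epsilon> :: real assume \<epsilon>: "0 < \<epsilon> \<and> \<epsilon> \<le> 1"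
    let ?\<delta> = "1 / real (h (nat \<lceil>1 / \<epsilon>\<rceil>))"
    show "\<exists>\<delta>. a * \<epsilon> powr b \<le> \<delta> \<and> 0 < \<delta> \<and>
      (\<forall>G :: nat ugraph. simple_graph G \<and> 1 / \<delta> \<le> real (card (vertices G)) \<and>
         (\<forall>F\<in>\<F>. real (card (induced_copies F G)) < \<delta> * real (card (vertices G)) ^ card (vertices F)) \<longrightarrow>
         (\<exists>X. homogeneous \<epsilon> G X \<and> \<delta> * real (card (vertices G)) \<le> real (card X)))"
    proof (rule exI[of _ ?\<delta>], intro conjI allI impI; (elim conjE)?)
      show "a * \<epsilon> powr b \<le> ?\<delta>" using ab(3) \<epsilon> by simp
      show "0 < ?\<delta>" using h1[of "nat \<lceil>1 / \<epsilon>\<rceil>"] by simp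
    qed (rule main, use \<epsilon> in simp_all)
  qed
qed

end
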